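(* Let $G$ be a locally compact Hausdorff abelian group and let $w$ be a Borel measurable weight function on $G$ with $w\ge 1$. Then $M_b(G,w)$ is a type I-BSE algebra if and only if $G$ is finite.
   Context: A weight on $G$ is a Borel measurable function $w:G\to\mathbb{R}^{+}=(0,\infty)$ with $w(xy)\le w(x)w(y)$ for all $x,y\in G$. $M_b(G)$ is the Banach algebra of bounded regular complex Borel measures on $G$ under convolution. For $w\ge 1$, $M_b(G,w)=\{\mu\in M_b(G):\mu w\in M_b(G)\}$ where $\mu w(E)=\int_E w\,d\mu$, with norm $\|\mu\|_w=\|\mu w\|$ (total variation norm) and convolution product. For a commutative Banach algebra $\mathcal{B}$, $\Delta(\mathcal{B})$ is the character space (nonzero multiplicative linear functionals) with the Gelfand topology, $C_b(\Delta(\mathcal{B}))$ is the algebra of bounded continuous complex functions on it, and $\hat b(\varphi)=\varphi(b)$. A function $\sigma\in C_b(\Delta(\mathcal{B}))$ is a BSE-function if there is $\beta>0$ such that $\big|\sum_{j=1}^n c_j\sigma(\varphi_j)\big|\le\beta\big\|\sum_{j=1}^n c_j\varphi_j\big\|_{\mathcal{B}^{\ast}}$ for all $n$, all $c_1,\dots,c_n\in\mathbb{C}$ and $\varphi_1,\dots,\varphi_n\in\Delta(\mathcal{B})$; $C_{BSE}(\Delta(\mathcal{B}))$ is the set of BSE-functions. $\mathcal{B}$ is without order if $b\mathcal{B}=\{0\}$ implies $b=0$. For $\mathcal{B}$ commutative and without order, $M(\mathcal{B})$ is the algebra of bounded linear $T:\mathcal{B}\to\mathcal{B}$ with $T(ab)=aT(b)$;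 for each $T\in M(\mathcal{B})$ there is a unique $\widehat T\in C_b(\Delta(\mathcal{B}))$ with $\widehat{T(b)}=\widehat T\,\hat b$ for all $b$, and $\widehat{M(\mathcal{B})}=\{\widehat T:T\in M(\mathcal{B})\}$. $\mathcal{B}$ (commutative, without order) is a BSE-algebra if $C_{BSE}(\Delta(\mathcal{B}))=\widehat{M(\mathcal{B})}$, and a type I-BSE algebra if it is a BSE-algebra and $C_{BSE}(\Delta(\mathcal{B}))=C_b(\Delta(\mathcal{B}))$. *)

theory Defs
  imports "HOL-Analysis.Analysis"
begin

section \<open>Commutative complex Banach algebras\<close>

text \<open>
  The algebras of interest depend on a weight function, so they cannot be types; an algebra is a
  record with an explicit carrier. No unit is required.
\<close>

record 'b complex_algebra =
  acarrier :: "'b set"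
  azero :: "'b"
  aplus :: "'b \<Rightarrow> 'b \<Rightarrow> 'b"
  ascale :: "complex \<Rightarrow> 'b \<Rightarrow> 'b"
  amult :: "'b \<Rightarrow> 'b \<Rightarrow> 'b"
  anorm :: "'b \<Rightarrow> real"

definition aminus :: "'b complex_algebra \<Rightarrow> 'b \<Rightarrow> 'b \<Rightarrow> 'b" where
  "aminus B x y = aplus B x (ascale B (-1) y)"

locale commutative_banach_algebra =
  fixes B :: "'b complex_algebra"
  assumes zero_closed: "azero B \<in> acarrier B"
    and plus_closed: "\<lbrakk>x \<in> acarrier B; y \<in> acarrier B\<rbrakk> \<Longrightarrow> aplus B x y \<in> acarrier B"
    and scale_closed: "x \<in> acarrier B \<Longrightarrow> ascale B a x \<in> acarrier B"
    and mult_closed: "\<lbrakk>x \<in> acarrier B; y \<in> acarrier B\<rbrakk> \<Longrightarrow> amult B x y \<in> acarrier B"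
    and plus_assoc: "\<lbrakk>x \<in> acarrier B; y \<in> acarrier B; z \<in> acarrier B\<rbrakk>
      \<Longrightarrow> aplus B (aplus B x y) z = aplus B x (aplus B y z)"
    and plus_commute: "\<lbrakk>x \<in> acarrier B; y \<in> acarrier B\<rbrakk> \<Longrightarrow> aplus B x y = aplus B y x"
    and plus_zero: "x \<in> acarrier B \<Longrightarrow> aplus B x (azero B) = x"
    and minus_self: "x \<in> acarrier B \<Longrightarrow> aminus B x x = azero B"
    and scale_plus_right: "\<lbrakk>x \<in> acarrier B; y \<in> acarrier B\<rbrakk>
      \<Longrightarrow> ascale B a (aplus B x y) = aplus B (ascale B a x) (ascale B a y)"
    and scale_plus_left: "x \<in> acarrier B
      \<Longrightarrow> ascale B (a + c) x = aplus B (ascale B a x) (ascale B c x)"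
    and scale_scale: "x \<in> acarrier B \<Longrightarrow> ascale B a (ascale B c x) = ascale B (a * c) x"
    and scale_one: "x \<in> acarrier B \<Longrightarrow> ascale B 1 x = x"
    and mult_assoc: "\<lbrakk>x \<in> acarrier B; y \<in> acarrier B; z \<in> acarrier B\<rbrakk>
      \<Longrightarrow> amult B (amult B x y) z = amult B x (amult B y z)"
    and mult_commute: "\<lbrakk>x \<in> acarrier B; y \<in> acarrier B\<rbrakk> \<Longrightarrow> amult B x y = amult B y x"
    and mult_plus: "\<lbrakk>x \<in> acarrier B; y \<in> acarrier B; z \<in> acarrier B\<rbrakk>
      \<Longrightarrow> amult B x (aplus B y z) = aplus B (amult B x y) (amult B x z)"
    and mult_scale: "\<lbrakk>x \<in> acarrier B; y \<in> acarrier B\<rbrakk>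
      \<Longrightarrow> amult B x (ascale B a y) = ascale B a (amult B x y)"
    and norm_nonneg: "x \<in> acarrier B \<Longrightarrow> 0 \<le> anorm B x"
    and norm_eq_zero: "x \<in> acarrier B \<Longrightarrow> anorm B x = 0 \<longleftrightarrow> x = azero B"
    and norm_triangle: "\<lbrakk>x \<in> acarrier B; y \<in> acarrier B\<rbrakk>
      \<Longrightarrow> anorm B (aplus B x y) \<le> anorm B x + anorm B y"
    and norm_scale: "x \<in> acarrier B \<Longrightarrow> anorm B (ascale B a x) = cmod a * anorm B x"
    and norm_mult: "\<lbrakk>x \<in> acarrier B; y \<in> acarrier B\<rbrakk>
      \<Longrightarrow> anorm B (amult B x y) \<le> anorm B x * anorm B y"
    and complete: "\<lbrakk>\<And>n. X n \<in> acarrier B;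
        \<And>e. e > 0 \<Longrightarrow> \<exists>N. \<forall>m\<ge>N. \<forall>n\<ge>N. anorm B (aminus B (X m) (X n)) < e\<rbrakk>
      \<Longrightarrow> \<exists>x\<in>acarrier B. (\<lambda>n. anorm B (aminus B (X n) x)) \<longlonglongrightarrow> 0"

definition without_order :: "'b complex_algebra \<Rightarrow> bool" where
  "without_order B \<longleftrightarrow>
    (\<forall>b\<in>acarrier B. amult B b ` acarrier B = {azero B} \<longrightarrow> b = azero B)"

section \<open>Character space and BSE-functions\<close>

text \<open>
  Functionals on \<open>B\<close> are extensional functions on the carrier, so that each is represented exactly
  once; likewise for functions on the character space and for multipliers.
\<close>

definition character_space :: "'b complex_algebra \<Rightarrow> ('b \<Rightarrow> complex) set" where
  "character_space B =
    {\<phi> \<in> extensional (acarrier B).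
      (\<forall>x\<in>acarrier B. \<forall>y\<in>acarrier B. \<phi> (aplus B x y) = \<phi> x + \<phi> y) \<and>
      (\<forall>a. \<forall>x\<in>acarrier B. \<phi> (ascale B a x) = a * \<phi> x) \<and>
      (\<forall>x\<in>acarrier B. \<forall>y\<in>acarrier B. \<phi> (amult B x y) = \<phi> x * \<phi> y) \<and>
      (\<exists>x\<in>acarrier B. \<phi> x \<noteq> 0)}"

definition gelfand_topology :: "'b complex_algebra \<Rightarrow> ('b \<Rightarrow> complex) topology" where
  "gelfand_topology B =
    subtopology (product_topology (\<lambda>_. euclidean) (acarrier B)) (character_space B)"

definition Cb_character_space :: "'b complex_algebra \<Rightarrow> (('b \<Rightarrow> complex) \<Rightarrow> complex) set" where
  "Cb_character_space B =
    {\<sigma> \<in> extensional (character_space B).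
      continuous_map (gelfand_topology B) euclidean \<sigma> \<and> bounded (\<sigma> ` character_space B)}"

definition dual_norm :: "'b complex_algebra \<Rightarrow> ('b \<Rightarrow> complex) \<Rightarrow> real" where
  "dual_norm B f = (SUP b\<in>{b \<in> acarrier B. anorm B b \<le> 1}. cmod (f b))"

definition C_BSE :: "'b complex_algebra \<Rightarrow> (('b \<Rightarrow> complex) \<Rightarrow> complex) set" where
  "C_BSE B =
    {\<sigma> \<in> Cb_character_space B. \<exists>\<beta>>0. \<forall>(n::nat) (c :: nat \<Rightarrow> complex) (\<phi> :: nat \<Rightarrow> 'b \<Rightarrow> complex).
      (\<forall>j<n. \<phi> j \<in> character_space B) \<longrightarrow>
      cmod (\<Sum>j<n. c j * \<sigma> (\<phi> j)) \<le> \<beta> * dual_norm B (\<lambda>b. \<Sum>j<n. c j * \<phi> j b)}"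

section \<open>Multipliers and BSE-algebras\<close>

definition multipliers :: "'b complex_algebra \<Rightarrow> ('b \<Rightarrow> 'b) set" where
  "multipliers B =
    {T \<in> acarrier B \<rightarrow>\<^sub>E acarrier B.
      (\<forall>x\<in>acarrier B. \<forall>y\<in>acarrier B. T (aplus B x y) = aplus B (T x) (T y)) \<and>
      (\<forall>a. \<forall>x\<in>acarrier B. T (ascale B a x) = ascale B a (T x)) \<and>
      (\<exists>K. \<forall>x\<in>acarrier B. anorm B (T x) \<le> K * anorm B x) \<and>
      (\<forall>x\<in>acarrier B. \<forall>y\<in>acarrier B. T (amult B x y) = amult B x (T y))}"

definition multiplier_transform ::
  "'b complex_algebra \<Rightarrow> ('b \<Rightarrow> 'b) \<Rightarrow> ('b \<Rightarrow> complex) \<Rightarrow> complex" where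
  "multiplier_transform B T =
    (THE \<sigma>. \<sigma> \<in> Cb_character_space B \<and>
      (\<forall>b\<in>acarrier B. \<forall>\<phi>\<in>character_space B. \<phi> (T b) = \<sigma> \<phi> * \<phi> b))"

definition BSE_algebra :: "'b complex_algebra \<Rightarrow> bool" where
  "BSE_algebra B \<longleftrightarrow> commutative_banach_algebra B \<and> without_order B \<and>
    C_BSE B = multiplier_transform B ` multipliers B"

definition type_I_BSE_algebra :: "'b complex_algebra \<Rightarrow> bool" where
  "type_I_BSE_algebra B \<longleftrightarrow> BSE_algebra B \<and> C_BSE B = Cb_character_space B"

section \<open>Regular complex Borel measures\<close>

text \<open>
  A complex Borel measure is a countably additive set function on the Borel sets, set to \<open>0\<close> on the
  other sets so that equality, sums and scalar multiples are those of functions.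
\<close>

definition complex_borel_measure :: "('a::topological_space set \<Rightarrow> complex) \<Rightarrow> bool" where
  "complex_borel_measure \<mu> \<longleftrightarrow>
    (\<forall>E. E \<notin> sets borel \<longrightarrow> \<mu> E = 0) \<and>
    (\<forall>A :: nat \<Rightarrow> 'a set. range A \<subseteq> sets borel \<longrightarrow> disjoint_family A \<longrightarrow>
      (\<lambda>i. \<mu> (A i)) sums \<mu> (\<Union>i. A i))"

definition total_variation :: "('a::topological_space set \<Rightarrow> complex) \<Rightarrow> 'a set \<Rightarrow> ennreal" where
  "total_variation \<mu> E =
    (SUP P\<in>{P. finite P \<and> P \<subseteq> sets borel \<and> partition_on E P}. \<Sum>A\<in>P. ennreal (cmod (\<mu> A)))"

definition variation_measure :: "('a::topological_space set \<Rightarrow> complex) \<Rightarrow> 'a measure" where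
  "variation_measure \<mu> = measure_of UNIV (sets borel) (total_variation \<mu>)"

definition regular_measure :: "('a::topological_space set \<Rightarrow> complex) \<Rightarrow> bool" where
  "regular_measure \<mu> \<longleftrightarrow>
    (\<forall>E\<in>sets borel.
      total_variation \<mu> E = (INF U\<in>{U. open U \<and> E \<subseteq> U}. total_variation \<mu> U) \<and>
      total_variation \<mu> E = (SUP K\<in>{K. compact K \<and> K \<subseteq> E}. total_variation \<mu> K))"

definition bounded_regular_measures :: "('a::topological_space set \<Rightarrow> complex) set" where
  "bounded_regular_measures =
    {\<mu>. complex_borel_measure \<mu> \<and> total_variation \<mu> UNIV < \<infinity> \<and> regular_measure \<mu>}"

text \<open>
  The positive part of the Jordan decomposition of a real measure \<open>\<nu>\<close>,
  \<open>\<nu>\<^sup>+(E) = sup {\<nu>(A) | A \<subseteq> E Borel}\<close>. Negative values of \<open>\<nu>\<close> are cut off at \<open>0\<close> by \<^const>\<open>ennreal\<close>;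
  this does not change the supremum because \<open>\<nu> {} = 0\<close>. The negative part is the positive part
  of \<open>- \<nu>\<close>.
\<close>

definition positive_part :: "('a::topological_space set \<Rightarrow> real) \<Rightarrow> 'a measure" where
  "positive_part \<nu> =
    measure_of UNIV (sets borel) (\<lambda>E. SUP A\<in>{A \<in> sets borel. A \<subseteq> E}. ennreal (\<nu> A))"

definition complex_integral ::
  "('a::topological_space set \<Rightarrow> complex) \<Rightarrow> ('a \<Rightarrow> complex) \<Rightarrow> complex" where
  "complex_integral \<mu> f =
    (integral\<^sup>L (positive_part (\<lambda>E. Re (\<mu> E))) f - integral\<^sup>L (positive_part (\<lambda>E. - Re (\<mu> E))) f) +
    \<i> * (integral\<^sup>L (positive_part (\<lambda>E. Im (\<mu> E))) f - integral\<^sup>L (positive_part (\<lambda>E. - Im (\<mu> E))) f)"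

text \<open>
  Convolution is \<open>(\<mu> * \<nu>)(E) = \<integral> \<mu>(E - y) d\<nu>(y)\<close>. This avoids the product measure, whose
  \<open>\<sigma>\<close>-algebra can be strictly smaller than the Borel sets of the product space when the group is
  not second countable. For regular \<open>\<mu>\<close> the integrand is Borel measurable and bounded.
\<close>

definition convolution ::
  "('a::topological_ab_group_add set \<Rightarrow> complex) \<Rightarrow> ('a set \<Rightarrow> complex) \<Rightarrow> 'a set \<Rightarrow> complex" where
  "convolution \<mu> \<nu> E =
    (if E \<in> sets borel then complex_integral \<nu> (\<lambda>y. \<mu> ((\<lambda>x. x + y) -` E)) else 0)"

section \<open>Weighted measure algebras\<close>

definition weight :: "('a::topological_ab_group_add \<Rightarrow> real) \<Rightarrow> bool" where
  "weight w \<longleftrightarrow>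
    w \<in> borel_measurable borel \<and> (\<forall>x. 0 < w x) \<and> (\<forall>x y. w (x + y) \<le> w x * w y)"

definition weighted_measure ::
  "('a::topological_space \<Rightarrow> real) \<Rightarrow> ('a set \<Rightarrow> complex) \<Rightarrow> 'a set \<Rightarrow> complex" where
  "weighted_measure w \<mu> E =
    (if E \<in> sets borel then complex_integral \<mu> (\<lambda>x. complex_of_real (indicator E x * w x)) else 0)"

text \<open>
  Integrability of \<open>w\<close> with respect to \<open>\<bar>\<mu>\<bar>\<close> has to be required explicitly for \<open>\<mu>w\<close> to make sense,
  since the Bochner integral of a non-integrable function is \<open>0\<close> by convention.
\<close>

definition weighted_measure_algebra ::
  "('a::topological_ab_group_add \<Rightarrow> real) \<Rightarrow> ('a set \<Rightarrow> complex) complex_algebra" where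
  "weighted_measure_algebra w =
    \<lparr>acarrier = {\<mu> \<in> bounded_regular_measures.
        integrable (variation_measure \<mu>) w \<and> weighted_measure w \<mu> \<in> bounded_regular_measures},
     azero = (\<lambda>E. 0),
     aplus = (\<lambda>\<mu> \<nu> E. \<mu> E + \<nu> E),
     ascale = (\<lambda>a \<mu> E. a * \<mu> E),
     amult = convolution,
     anorm = (\<lambda>\<mu>. enn2real (total_variation (weighted_measure w \<mu>) UNIV))\<rparr>"

end

theory Submission
  imports Defs
begin

text \<open>
  Every homomorphism \<open>\<xi>\<close> from the discrete group \<open>G\<close> to the unit circle gives a character
  \<open>\<mu> \<mapsto> \<Sum>\<^sub>x \<mu>{x} \<xi>(x)\<close> of the algebra, because the atomic part of a convolution is the convolution of
  the atomic parts. If \<open>G\<close> is infinite, there are infinitely many such \<open>\<xi>\<close>, and the Rudin-Shapiro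
  recursion yields sign combinations of \<open>2\<^sup>n\<close> distinct ones with supremum norm, hence dual norm, at
  most \<open>2\<^bsup>(n+1)/2\<^esup>\<close>. A continuous function on the character space may follow these signs, so if all
  bounded continuous functions were BSE-functions, a gliding hump would bound \<open>2\<^sup>n\<close> by a multiple of
  \<open>2\<^bsup>n/2\<^esup>\<close>.

  If \<open>G\<close> is finite, the algebra is unital with finite spectrum, so every function on the spectrum is
  the Gelfand transform of an element, hence of a multiplier, and is BSE.
\<close>

section \<open>Circle-valued characters of abelian groups\<close>

text \<open>The constant \<open>\<beta>\<close> of a BSE-function may depend on the function, so a
  single Rudin-Shapiro sum decides nothing: one continuous \<open>\<sigma>\<close> has to violate
  the inequality at all scales at once. This is what forces a gliding hump. Characters of the
  discrete group are available on every infinite group because they need only the divisibility of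
  the circle and Zorn's lemma. The price is that they may be non-measurable, so they cannot be
  integrated against \<open>\<mu>\<close>; everything has to go through the values
  \<open>\<mu> {x}\<close>. These are tame because \<open>w \<ge> 1\<close>: their absolute sum is
  at most the weighted norm, and therefore the supremum of a trigonometric polynomial on the group
  bounds its dual norm. For a finite group the same point values are coordinates, and the whole
  algebra becomes a weighted group algebra.\<close>

definition circle_chars :: "('a::ab_group_add \<Rightarrow> complex) set" where
  "circle_chars = {\<xi>. (\<forall>x y. \<xi> (x + y) = \<xi> x * \<xi> y) \<and> (\<forall>x. cmod (\<xi> x) = 1)}"

lemma circle_charsD:
  assumes "\<xi> \<in> circle_chars"
  shows "\<xi> (x + y) = \<xi> x * \<xi> y" "cmod (\<xi> x) = 1"
  using assms by (auto simp: circle_chars_def)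

lemma circle_chars_mult: "\<xi> \<in> circle_chars \<Longrightarrow> \<psi> \<in> circle_chars \<Longrightarrow> (\<lambda>x. \<xi> x * \<psi> x) \<in> circle_chars"
  by (auto simp: circle_chars_def norm_mult)

lemma circle_chars_one: "(\<lambda>x. 1) \<in> circle_chars"
  by (auto simp: circle_chars_def)

lemma circle_mult_cnj: "cmod z = 1 \<Longrightarrow> z * cnj z = 1"
  by (simp add: complex_norm_square [symmetric])

text \<open>The graph of a homomorphism from a subgroup into the circle. For relations, extension is
  inclusion and a chain is bounded by its union; single-valuedness follows from the condition at 0
  by taking quotients.\<close>

definition circle_partial_hom :: "('a::ab_group_add \<times> complex) set \<Rightarrow> bool" where
  "circle_partial_hom R \<longleftrightarrow> (0, 1) \<in> R \<and> (\<forall>x z. (x, z) \<in> R \<longrightarrow> cmod z = 1) \<and>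
     (\<forall>x z y u. (x, z) \<in> R \<longrightarrow> (y, u) \<in> R \<longrightarrow> (x - y, z / u) \<in> R) \<and>
     (\<forall>z. (0, z) \<in> R \<longrightarrow> z = 1)"

context
  fixes R :: "('a::ab_group_add \<times> complex) set"
  assumes R: "circle_partial_hom R"
begin

lemma partial_hom_zero: "(0, 1) \<in> R"
  and partial_hom_norm: "(x, z) \<in> R \<Longrightarrow> cmod z = 1"
  and partial_hom_diff: "(x, z) \<in> R \<Longrightarrow> (y, u) \<in> R \<Longrightarrow> (x - y, z / u) \<in> R"
  and partial_hom_kernel: "(0, z) \<in> R \<Longrightarrow> z = 1"
  using R unfolding circle_partial_hom_def by blast+

lemma partial_hom_nonzero: "(x, z) \<in> R \<Longrightarrow> z \<noteq> 0"
  using partial_hom_norm by fastforce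

lemma partial_hom_uminus: "(x, z) \<in> R \<Longrightarrow> (- x, 1 / z) \<in> R"
  using partial_hom_diff[OF partial_hom_zero] by fastforce

lemma partial_hom_add: "(x, z) \<in> R \<Longrightarrow> (y, u) \<in> R \<Longrightarrow> (x + y, z * u) \<in> R"
  using partial_hom_diff[of x z "- y" "1 / u"] partial_hom_uminus[of y u] by simp

lemma partial_hom_unique: assumes "(x, z) \<in> R" "(x, u) \<in> R" shows "z = u"
  using partial_hom_kernel[of "z / u"] partial_hom_diff[OF assms] partial_hom_nonzero[OF assms(2)]
  by simp

text \<open>In a bare additive group the \<open>n\<close>-fold multiple of \<open>x\<close> is
  written as the constant sum over \<open>i < n\<close>; this convention persists below.\<close>

lemma partial_hom_sum: "(x, z) \<in> R \<Longrightarrow> ((\<Sum>i<n. x), z ^ n) \<in> R"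
proof (induction n)
  case (Suc n)
  then show ?case using partial_hom_add[of "\<Sum>i<n. x" "z ^ n" x z] by (simp add: mult.commute)
qed (simp add: partial_hom_zero)

end

text \<open>Two roots that differ by the factor \<open>cis (2 * pi / k)\<close> cannot both be 1
  once \<open>k \<ge> 2\<close>. The demand \<open>z \<noteq> 1\<close> later makes an extended
  character nontrivial at the new point.\<close>

lemma exists_circle_root:
  assumes "cmod c = 1" "k \<ge> 2"
  shows "\<exists>z. z ^ k = c \<and> cmod z = 1 \<and> z \<noteq> 1"
proof -
  obtain t where t: "c = cis t"
    using assms(1) rcis_cmod_Arg[of c] by (metis rcis_def mult_1 of_real_1)
  define a where "a = cis (t / real k)"
  define b where "b = cis (2 * pi / real k)"
  have "a ^ k = c" "(a * b) ^ k = c"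
    using assms(2) unfolding power_mult_distrib a_def b_def t Complex.DeMoivre by simp_all
  moreover have "b \<noteq> 1"
  proof
    assume "b = 1"
    then have "cos (2 * pi / real k) = 1" by (simp add: b_def complex_eq_iff)
    then obtain n :: int where n: "2 * pi / real k = of_int n * 2 * pi"
      unfolding cos_one_2pi_int by blast
    then have "1 / real k = of_int n" using assms(2) by (simp add: field_simps)
    moreover have "0 < 1 / real k" "1 / real k < 1" using assms(2) by auto
    ultimately show False by simp
  qed
  moreover have "cmod a = 1" "cmod (a * b) = 1" by (simp_all add: a_def b_def norm_mult)
  ultimately show ?thesis by (cases "a = 1") auto
qed

lemma sum_const_add: "(\<Sum>i<m + n. x) = (\<Sum>i<m. x) + (\<Sum>i<n. x)"
  for x :: "'a::ab_group_add" and m n :: nat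
  by (induction n) (auto simp: add.assoc)

lemma sum_const_mult: "(\<Sum>i<m * n. x) = (\<Sum>i<n. \<Sum>j<m. x)"
  for x :: "'a::ab_group_add" and m n :: nat
  by (induction n) (simp_all add: sum_const_add add.commute)

text \<open>Divisibility of the circle at work: the value at \<open>x\<close> has to agree with
  \<open>R\<close> on those multiples of \<open>x\<close> that already lie in the domain. They are
  all multiples of the least positive one, if there is one, so a single root extraction
  suffices.\<close>

lemma partial_hom_extend:
  fixes R :: "('a::ab_group_add \<times> complex) set"
  assumes R: "circle_partial_hom R" and x: "x \<notin> Domain R"
  shows "\<exists>R' z. circle_partial_hom R' \<and> R \<subseteq> R' \<and> (x, z) \<in> R' \<and> z \<noteq> 1"
proof -
  note zero = partial_hom_zero[OF R] and add = partial_hom_add[OF R]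
    and diff = partial_hom_diff[OF R] and unique = partial_hom_unique[OF R]
    and msum = partial_hom_sum[OF R] and nz = partial_hom_nonzero[OF R]
  let ?m = "\<lambda>n::nat. \<Sum>i<n. x"
  have "\<exists>z. cmod z = 1 \<and> z \<noteq> 1 \<and> (\<forall>d v. (?m d, v) \<in> R \<longrightarrow> z ^ d = v)"
  proof (cases "\<exists>k>0. ?m k \<in> Domain R")
    case True
    define k where "k = (LEAST k. k > 0 \<and> ?m k \<in> Domain R)"
    have k: "k > 0" "?m k \<in> Domain R" using LeastI_ex[OF True] by (auto simp: k_def)
    have least: "k \<le> d" if "d > 0" "?m d \<in> Domain R" for d
      unfolding k_def using that by (intro Least_le) auto
    \<comment> \<open>Since \<open>x\<close> itself is outside the domain, the root has order at
      least 2, which leaves room to avoid the value 1.\<close>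
    have "k \<noteq> 1" using k x by (auto simp del: sum_constant)
    then have "k \<ge> 2" using k by simp
    from k obtain c where c: "(?m k, c) \<in> R" by blast
    obtain z where z: "z ^ k = c" "cmod z = 1" "z \<noteq> 1"
      using exists_circle_root[OF partial_hom_norm[OF R c] \<open>k \<ge> 2\<close>] by blast
    have "z ^ d = v" if v: "(?m d, v) \<in> R" for d v
    proof -
      have tk: "(?m (k * (d div k)), c ^ (d div k)) \<in> R"
        using msum[OF c, of "d div k"] by (simp add: sum_const_mult del: sum_constant)
      have split: "?m d = ?m (k * (d div k)) + ?m (d mod k)"
        by (metis sum_const_add mult_div_mod_eq)
      then have "(?m (d mod k), v / c ^ (d div k)) \<in> R"
        using diff[OF v tk] by simp
      \<comment> \<open>A nonzero remainder would be a smaller positive multiple in the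
        domain.\<close>
      then have "d mod k = 0"
        using least[of "d mod k"] k(1) by (meson DomainI leD mod_less_divisor neq0_conv)
      then have "(?m d, c ^ (d div k)) \<in> R" using tk split by (simp del: sum_constant)
      then have "v = c ^ (d div k)" using unique v by blast
      also have "\<dots> = z ^ (k * (d div k))" by (simp add: z(1)[symmetric] power_mult)
      also have "\<dots> = z ^ d" using \<open>d mod k = 0\<close> by auto
      finally show ?thesis by simp
    qed
    then show ?thesis using z by blast
  next
    case False
    \<comment> \<open>Only \<open>d = 0\<close> imposes a condition here, so any
      \<open>z \<noteq> 1\<close> on the circle would do.\<close>
    have "(-1) ^ d = v" if v: "(?m d, v) \<in> R" for d v
    proof -
      have "d = 0" using False v by (meson DomainI neq0_conv)
      with v show ?thesis using partial_hom_kernel[OF R] by simp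
    qed
    then show ?thesis by (intro exI[of _ "-1"]) auto
  qed
  then obtain z where z: "cmod z = 1" "z \<noteq> 1" and zv: "\<And>d v. (?m d, v) \<in> R \<Longrightarrow> z ^ d = v"
    by blast
  have z0: "z \<noteq> 0" using z by auto
  \<comment> \<open>The subgroup generated by the domain and \<open>x\<close>; the two natural
    exponents encode the integer coefficient \<open>p - q\<close> of \<open>x\<close>.\<close>
  define R' where "R' = {(y + ?m p - ?m q, u * z ^ p / z ^ q) | y u p q. (y, u) \<in> R}"
  have mem: "(y + ?m p - ?m q, u * z ^ p / z ^ q) \<in> R'" if "(y, u) \<in> R" for y u p q
    using that unfolding R'_def by blast
  have "circle_partial_hom R'"
    unfolding circle_partial_hom_def
  proof (intro conjI allI impI)
    show "(0, 1) \<in> R'" using mem[OF zero, of 0 0] by simp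
    show "cmod u = 1" if "(y, u) \<in> R'" for y u
      using that partial_hom_norm[OF R] z by (auto simp: R'_def norm_mult norm_divide norm_power)
    show "(a - b, s / t) \<in> R'" if "(a, s) \<in> R'" "(b, t) \<in> R'" for a s b t
    proof -
      from that(1) obtain y u p q where 1: "a = y + ?m p - ?m q" "s = u * z ^ p / z ^ q" "(y, u) \<in> R"
        unfolding R'_def by blast
      from that(2) obtain y' u' p' q' where 2: "b = y' + ?m p' - ?m q'" "t = u' * z ^ p' / z ^ q'"
        "(y', u') \<in> R" unfolding R'_def by blast
      have "a - b = (y - y') + ?m (p + q') - ?m (q + p')"
        by (simp only: 1 2 sum_const_add) (simp add: algebra_simps del: sum_constant)
      moreover have "s / t = (u / u') * z ^ (p + q') / z ^ (q + p')"
        using z0 nz[OF 2(3)] by (simp add: 1 2 field_simps power_add)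
      ultimately show ?thesis using mem[OF diff[OF 1(3) 2(3)]] by (simp del: sum_constant)
    qed
    \<comment> \<open>Well-definedness: the relation puts a multiple of \<open>x\<close> into the
      old domain, up to sign, where \<open>zv\<close> fixes the power of \<open>z\<close>. The case
      split makes the difference of \<open>p\<close> and \<open>q\<close> a natural number.\<close>
    show "s = 1" if s: "(0, s) \<in> R'" for s
    proof -
      from s obtain y u p q where 1: "0 = y + ?m p - ?m q" "s = u * z ^ p / z ^ q" and yu: "(y, u) \<in> R"
        unfolding R'_def by blast
      show ?thesis
      proof (cases "q \<le> p")
        case True
        have "?m p = ?m (p - q) + ?m q" using True sum_const_add[of x "p - q" q] by simp
        then have "?m (p - q) = - y" using 1 by (simp add: algebra_simps eq_neg_iff_add_eq_0 del: sum_constant)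
        then have "z ^ (p - q) = 1 / u" using zv[of "p - q" "1 / u"] partial_hom_uminus[OF R yu] by simp
        moreover have "z ^ p = z ^ (p - q) * z ^ q" using True by (simp add: power_add[symmetric])
        ultimately show ?thesis using z0 nz[OF yu] by (simp add: 1)
      next
        case False
        have "?m q = ?m (q - p) + ?m p" using False sum_const_add[of x "q - p" p] by simp
        then have "?m (q - p) = y" using 1 by (simp add: algebra_simps del: sum_constant)
        then have "z ^ (q - p) = u" using zv[of "q - p" u] yu by simp
        moreover have "z ^ q = z ^ (q - p) * z ^ p" using False by (simp add: power_add[symmetric])
        ultimately show ?thesis using z0 nz[OF yu] by (simp add: 1)
      qed
    qed
  qed
  moreover have "R \<subseteq> R'" using mem[of _ _ 0 0] by auto
  moreover have "(x, z) \<in> R'" using mem[OF zero, of 1 0] by simp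
  ultimately show ?thesis using z by blast
qed

text \<open>The trivial homomorphism on \<open>{0}\<close> is first extended to \<open>g\<close>
  with a value other than 1, then maximally; by \<open>partial_hom_extend\<close> a maximal
  extension is total.\<close>

lemma circle_chars_separate:
  fixes g :: "'a::ab_group_add"
  assumes "g \<noteq> 0"
  shows "\<exists>\<xi>\<in>circle_chars. \<xi> g \<noteq> 1"
proof -
  have "circle_partial_hom {(0 :: 'a, 1)}" by (auto simp: circle_partial_hom_def)
  from partial_hom_extend[OF this, of g] assms obtain R0 z
    where R0: "circle_partial_hom R0" "(g, z) \<in> R0" "z \<noteq> 1" by auto
  \<comment> \<open>Only relations above \<open>R0\<close> compete, so the maximal one keeps the
    value \<open>z\<close> at \<open>g\<close>.\<close>
  define \<F> where "\<F> = {R. circle_partial_hom R \<and> R0 \<subseteq> R}"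
  have "\<exists>M\<in>\<F>. \<forall>R\<in>\<F>. M \<subseteq> R \<longrightarrow> R = M"
  proof (rule subset_Zorn_nonempty)
    show "\<F> \<noteq> {}" using R0 by (auto simp: \<F>_def)
    fix \<C> assume C: "\<C> \<noteq> {}" "subset.chain \<F> \<C>"
    have CF: "\<C> \<subseteq> \<F>" using C(2) by (simp add: subset.chain_def)
    have lin: "A \<subseteq> B \<or> B \<subseteq> A" if "A \<in> \<C>" "B \<in> \<C>" for A B
      using C(2) that unfolding subset.chain_def by auto
    have hom: "circle_partial_hom A" if "A \<in> \<C>" for A using CF that by (auto simp: \<F>_def)
    have "circle_partial_hom (\<Union>\<C>)"
      unfolding circle_partial_hom_def
    proof (intro conjI allI impI)
      show "(0, 1) \<in> \<Union>\<C>" using C(1) partial_hom_zero[OF hom] by auto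
      show "cmod z = 1" if "(x, z) \<in> \<Union>\<C>" for x z using that partial_hom_norm[OF hom] by auto
      show "z = 1" if "(0, z) \<in> \<Union>\<C>" for z using that partial_hom_kernel[OF hom] by auto
      show "(x - y, z / u) \<in> \<Union>\<C>" if "(x, z) \<in> \<Union>\<C>" "(y, u) \<in> \<Union>\<C>" for x y z u
      proof -
        from that obtain A B where "A \<in> \<C>" "B \<in> \<C>" "(x, z) \<in> A" "(y, u) \<in> B" by blast
        then obtain D where D: "D \<in> \<C>" "(x, z) \<in> D" "(y, u) \<in> D" using lin[of A B] by blast
        show ?thesis using partial_hom_diff[OF hom[OF D(1)] D(2,3)] D(1) by blast
      qed
    qed
    then show "\<Union>\<C> \<in> \<F>" using C(1) CF by (auto simp: \<F>_def)
  qed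
  then obtain M where M: "M \<in> \<F>" and max: "\<And>R. R \<in> \<F> \<Longrightarrow> M \<subseteq> R \<Longrightarrow> R = M" by blast
  have hM: "circle_partial_hom M" "R0 \<subseteq> M" using M by (auto simp: \<F>_def)
  have total: "\<exists>u. (x, u) \<in> M" for x
  proof (rule ccontr)
    assume "\<not> ?thesis"
    then have "x \<notin> Domain M" by blast
    from partial_hom_extend[OF hM(1) this] obtain R' u
      where R': "circle_partial_hom R'" "M \<subseteq> R'" "(x, u) \<in> R'" by blast
    then have "R' = M" using max hM by (auto simp: \<F>_def)
    then show False using R' \<open>x \<notin> Domain M\<close> by blast
  qed
  define \<xi> where "\<xi> x = (THE u. (x, u) \<in> M)" for x
  have chi: "(x, u) \<in> M \<longleftrightarrow> u = \<xi> x" for x u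
  proof -
    obtain v where v: "(x, v) \<in> M" using total by blast
    then have "\<xi> x = v" unfolding \<xi>_def using partial_hom_unique[OF hM(1)] by (intro the_equality) blast+
    with v show ?thesis using partial_hom_unique[OF hM(1)] by blast
  qed
  have "\<xi> \<in> circle_chars"
  proof -
    have mem: "(x, \<xi> x) \<in> M" for x by (simp add: chi)
    have "\<xi> (x + y) = \<xi> x * \<xi> y" for x y
      using partial_hom_add[OF hM(1) mem mem, of x y] by (simp add: chi)
    moreover have "cmod (\<xi> x) = 1" for x using partial_hom_norm[OF hM(1) mem] .
    ultimately show ?thesis by (simp add: circle_chars_def)
  qed
  moreover have "\<xi> g = z" using R0(2) hM(2) chi by auto
  then have "\<xi> g \<noteq> 1" using R0(3) by simp
  ultimately show ?thesis by blast
qed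

lemma circle_chars_diff: "\<xi> \<in> circle_chars \<Longrightarrow> \<xi> (x - y) = \<xi> x / \<xi> y"
  using circle_charsD(1)[of \<xi> "x - y" y] circle_charsD(2)[of \<xi> y]
  by (cases "\<xi> y = 0") auto

text \<open>A finite family of characters takes values in a finite group of roots of unity, and
  characters separate points.\<close>

lemma infinite_circle_chars:
  assumes "infinite (UNIV :: 'a::ab_group_add set)"
  shows "infinite (circle_chars :: ('a \<Rightarrow> complex) set)"
proof
  let ?X = "circle_chars :: ('a \<Rightarrow> complex) set"
  assume fin: "finite ?X"
  have fin_range: "finite (range \<xi>)" if "\<xi> \<in> ?X" for \<xi>
  proof -
    have pw: "(\<lambda>x. \<xi> x ^ n) \<in> ?X" for n
      using that by (auto simp: circle_chars_def power_mult_distrib norm_power)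
    \<comment> \<open>Powers of a character are characters. If there are only finitely many
      characters, two powers agree and all values are roots of unity of one order.\<close>
    have "\<not> inj_on (\<lambda>n x. \<xi> x ^ n) (UNIV :: nat set)"
    proof
      assume "inj_on (\<lambda>n x. \<xi> x ^ n) (UNIV :: nat set)"
      moreover have "range (\<lambda>n x. \<xi> x ^ n) \<subseteq> ?X" using pw by blast
      ultimately show False using finite_imageD finite_subset fin infinite_UNIV_nat by blast
    qed
    then obtain m n :: nat where "m \<noteq> n" "(\<lambda>x. \<xi> x ^ m) = (\<lambda>x. \<xi> x ^ n)"
      unfolding inj_on_def by blast
    then obtain m n :: nat where mn: "m < n" "(\<lambda>x. \<xi> x ^ m) = (\<lambda>x. \<xi> x ^ n)"
      by (cases m n rule: linorder_cases) auto
    have "\<xi> x ^ (n - m) = 1" for x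
    proof -
      have "\<xi> x ^ m * \<xi> x ^ (n - m) = \<xi> x ^ m"
        using mn(1) fun_cong[OF mn(2), of x] power_add[of "\<xi> x" m "n - m"] by simp
      then show ?thesis using circle_charsD(2)[OF that, of x] by auto
    qed
    then have "range \<xi> \<subseteq> {z. z ^ (n - m) = 1}" by auto
    moreover have "finite {z::complex. z ^ (n - m) = 1}" using mn by (intro finite_roots_unity) simp
    ultimately show ?thesis by (rule finite_subset)
  qed
  define F where "F x = restrict (\<lambda>\<xi>. \<xi> x) ?X" for x :: 'a
  have "inj F"
  proof (rule injI, rule ccontr)
    fix x y assume "F x = F y" "x \<noteq> y"
    obtain \<xi> where chi: "\<xi> \<in> ?X" "\<xi> (x - y) \<noteq> 1" using circle_chars_separate[of "x - y"] \<open>x \<noteq> y\<close> by auto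
    have "\<xi> x = \<xi> y" using \<open>F x = F y\<close> chi by (metis F_def restrict_apply')
    then show False using chi circle_chars_diff[OF chi(1), of x y] circle_charsD(2)[OF chi(1), of y]
      by (cases "\<xi> y = 0") auto
  qed
  moreover have "range F \<subseteq> (\<Pi>\<^sub>E \<xi>\<in>?X. range \<xi>)" by (auto simp: F_def)
  then have "finite (range F)" using finite_PiE[OF fin fin_range] by (rule finite_subset)
  ultimately show False using assms finite_imageD by blast
qed

section \<open>Rudin-Shapiro polynomials\<close>

text \<open>The pair \<open>(P, Q)\<close> of signed sums is replaced by
  \<open>(P + \<psi> Q, P - \<psi> Q)\<close>. As \<open>\<psi>\<close> has modulus 1, the
  parallelogram law doubles the sum of squared moduli at every point, exactly as the number of
  characters doubles.\<close>

lemma rudin_shapiro_pair: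
  assumes inf: "infinite (circle_chars :: ('a::ab_group_add \<Rightarrow> complex) set)"
  shows "\<exists>S c d. S \<subseteq> circle_chars \<and> card S = 2 ^ n \<and> (\<forall>\<xi>\<in>S. c \<xi> \<in> {1, -1 :: real} \<and> d \<xi> \<in> {1, -1 :: real}) \<and>
    (\<forall>x::'a. (cmod (\<Sum>\<xi>\<in>S. c \<xi> * \<xi> x))\<^sup>2 + (cmod (\<Sum>\<xi>\<in>S. d \<xi> * \<xi> x))\<^sup>2 = 2 ^ (n + 1))"
proof (induction n)
  case 0
  have "{\<lambda>x::'a. 1} \<subseteq> circle_chars" by (simp add: circle_chars_one)
  then show ?case
    by (intro exI[of _ "{\<lambda>x. 1}"] exI[of _ "\<lambda>_. 1"]) simp
next
  case (Suc n)
  from Suc.IH obtain S :: "('a \<Rightarrow> complex) set" and c d :: "('a \<Rightarrow> complex) \<Rightarrow> real"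
    where Scd: "S \<subseteq> circle_chars \<and> card S = 2 ^ n \<and> (\<forall>\<xi>\<in>S. c \<xi> \<in> {1, -1 :: real} \<and> d \<xi> \<in> {1, -1 :: real}) \<and>
      (\<forall>x. (cmod (\<Sum>\<xi>\<in>S. c \<xi> * \<xi> x))\<^sup>2 + (cmod (\<Sum>\<xi>\<in>S. d \<xi> * \<xi> x))\<^sup>2 = 2 ^ (n + 1))"
    by (elim exE)
  then have S: "S \<subseteq> circle_chars" "card S = 2 ^ n"
    and cd: "\<And>\<xi>. \<xi> \<in> S \<Longrightarrow> c \<xi> \<in> {1, -1}" "\<And>\<xi>. \<xi> \<in> S \<Longrightarrow> d \<xi> \<in> {1, -1}"
    and sum: "\<And>x. (cmod (\<Sum>\<xi>\<in>S. c \<xi> * \<xi> x))\<^sup>2 + (cmod (\<Sum>\<xi>\<in>S. d \<xi> * \<xi> x))\<^sup>2 = 2 ^ (n + 1)"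
    by simp_all
  have fin: "finite S" using S(2) card.infinite by fastforce
  \<comment> \<open>A \<open>\<psi>\<close> outside the finitely many quotients of members of
    \<open>S\<close> makes the translate of \<open>S\<close> by \<open>\<psi>\<close> disjoint from
    \<open>S\<close>, so no two terms merge.\<close>
  have "finite ((\<lambda>(\<alpha>, \<beta>) x. \<alpha> x * cnj (\<beta> x)) ` (S \<times> S))" using fin by simp
  then obtain \<psi> where psi: "\<psi> \<in> circle_chars" and
    new: "\<psi> \<notin> (\<lambda>(\<alpha>, \<beta>) x. \<alpha> x * cnj (\<beta> x)) ` (S \<times> S)"
    using inf by (meson finite_subset subsetI)
  define h where "h \<xi> = (\<lambda>x. \<psi> x * \<xi> x)" for \<xi> :: "'a \<Rightarrow> complex"
  define k where "k \<xi> = (\<lambda>x. cnj (\<psi> x) * \<xi> x)" for \<xi> :: "'a \<Rightarrow> complex"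
  have one: "cnj (\<psi> x) * \<psi> x = 1" for x
    using circle_mult_cnj[OF circle_charsD(2)[OF psi]] by (simp add: mult.commute)
  have kh: "k (h \<xi>) = \<xi>" for \<xi>
    unfolding k_def h_def by (simp add: one flip: mult.assoc)
  have inj: "inj_on h S" using kh by (metis inj_onI)
  have disj: "S \<inter> h ` S = {}"
  proof (rule ccontr)
    assume "S \<inter> h ` S \<noteq> {}"
    then obtain \<beta> where b: "\<beta> \<in> S" "h \<beta> \<in> S" by blast
    have "\<psi> = (\<lambda>x. h \<beta> x * cnj (\<beta> x))"
      using circle_mult_cnj[OF circle_charsD(2), of \<beta>] S b by (auto simp: h_def mult.assoc)
    then show False using new b by (auto simp: image_iff)
  qed
  let ?S = "S \<union> h ` S"
  \<comment> \<open>Coefficients of \<open>P + \<psi> Q\<close> and, in \<open>d'\<close>, of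
    \<open>P - \<psi> Q\<close>; on the translate, \<open>k\<close> undoes the multiplication by
    \<open>\<psi>\<close>.\<close>
  define c' where "c' \<xi> = (if \<xi> \<in> S then c \<xi> else d (k \<xi>))" for \<xi>
  define d' where "d' \<xi> = (if \<xi> \<in> S then c \<xi> else - d (k \<xi>))" for \<xi>
  have sum_split: "(\<Sum>\<xi>\<in>?S. f \<xi> * \<xi> x) = (\<Sum>\<xi>\<in>S. f \<xi> * \<xi> x) + \<psi> x * (\<Sum>\<xi>\<in>S. f (h \<xi>) * \<xi> x)"
    for f :: "_ \<Rightarrow> complex" and x
  proof -
    have "(\<Sum>\<xi>\<in>?S. f \<xi> * \<xi> x) = (\<Sum>\<xi>\<in>S. f \<xi> * \<xi> x) + (\<Sum>\<xi>\<in>h ` S. f \<xi> * \<xi> x)"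
      using fin disj by (intro sum.union_disjoint) auto
    also have "(\<Sum>\<xi>\<in>h ` S. f \<xi> * \<xi> x) = (\<Sum>\<xi>\<in>S. f (h \<xi>) * h \<xi> x)"
      using inj by (simp add: sum.reindex)
    also have "\<dots> = \<psi> x * (\<Sum>\<xi>\<in>S. f (h \<xi>) * \<xi> x)"
      unfolding sum_distrib_left by (intro sum.cong) (auto simp: h_def[of _])
    finally show ?thesis .
  qed
  have hS: "h \<xi> \<notin> S" if "\<xi> \<in> S" for \<xi> using disj that by blast
  have sum_c: "(\<Sum>\<xi>\<in>?S. c' \<xi> * \<xi> x) = (\<Sum>\<xi>\<in>S. c \<xi> * \<xi> x) + \<psi> x * (\<Sum>\<xi>\<in>S. d \<xi> * \<xi> x)" for x
    unfolding sum_split using hS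
    by (auto simp: c'_def kh intro!: arg_cong2[where f = "(+)"] arg_cong2[where f = "(*)"] sum.cong)
  have sum_d: "(\<Sum>\<xi>\<in>?S. d' \<xi> * \<xi> x) = (\<Sum>\<xi>\<in>S. c \<xi> * \<xi> x) - \<psi> x * (\<Sum>\<xi>\<in>S. d \<xi> * \<xi> x)" for x
  proof -
    have "(\<Sum>\<xi>\<in>S. d' (h \<xi>) * \<xi> x) = - (\<Sum>\<xi>\<in>S. d \<xi> * \<xi> x)"
      unfolding sum_negf[symmetric] using hS by (intro sum.cong) (auto simp: d'_def kh)
    moreover have "(\<Sum>\<xi>\<in>S. d' \<xi> * \<xi> x) = (\<Sum>\<xi>\<in>S. c \<xi> * \<xi> x)"
      by (intro sum.cong) (auto simp: d'_def)
    ultimately show ?thesis unfolding sum_split by simp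
  qed
  have par: "(cmod (a + b))\<^sup>2 + (cmod (a - b))\<^sup>2 = 2 * ((cmod a)\<^sup>2 + (cmod b)\<^sup>2)" for a b
    unfolding cmod_power2 by (simp add: power2_eq_square algebra_simps)
  show ?case
  proof (rule exI[of _ ?S], rule exI[of _ c'], rule exI[of _ d'], intro conjI allI)
    show "?S \<subseteq> circle_chars" using S circle_chars_mult[OF psi] by (auto simp: h_def)
    show "card ?S = 2 ^ Suc n" using S fin disj inj by (simp add: card_Un_disjoint card_image)
    show "\<forall>\<xi>\<in>?S. c' \<xi> \<in> {1, -1} \<and> d' \<xi> \<in> {1, -1}"
      using cd by (fastforce simp: c'_def d'_def kh)
    show "(cmod (\<Sum>\<xi>\<in>?S. c' \<xi> * \<xi> x))\<^sup>2 + (cmod (\<Sum>\<xi>\<in>?S. d' \<xi> * \<xi> x))\<^sup>2 = 2 ^ (Suc n + 1)" for x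
      unfolding sum_c sum_d par using sum[of x] circle_charsD(2)[OF psi, of x] by (simp add: norm_mult)
  qed
qed

lemma rudin_shapiro:
  assumes "infinite (circle_chars :: ('a::ab_group_add \<Rightarrow> complex) set)"
  shows "\<exists>S c. S \<subseteq> circle_chars \<and> card S = 2 ^ n \<and> (\<forall>\<xi>\<in>S. c \<xi> \<in> {1, -1 :: real}) \<and>
    (\<forall>x::'a. cmod (\<Sum>\<xi>\<in>S. c \<xi> * \<xi> x) \<le> sqrt (2 ^ (n + 1)))"
proof -
  obtain S :: "('a \<Rightarrow> complex) set" and c d
    where Scd: "S \<subseteq> circle_chars \<and> card S = 2 ^ n \<and> (\<forall>\<xi>\<in>S. c \<xi> \<in> {1, -1 :: real} \<and> d \<xi> \<in> {1, -1 :: real}) \<and>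
      (\<forall>x. (cmod (\<Sum>\<xi>\<in>S. c \<xi> * \<xi> x))\<^sup>2 + (cmod (\<Sum>\<xi>\<in>S. d \<xi> * \<xi> x))\<^sup>2 = 2 ^ (n + 1))"
    using rudin_shapiro_pair[OF assms, of n] by (elim exE)
  then have "(cmod (\<Sum>\<xi>\<in>S. c \<xi> * \<xi> x))\<^sup>2 + (cmod (\<Sum>\<xi>\<in>S. d \<xi> * \<xi> x))\<^sup>2 = 2 ^ (n + 1)" for x
    by simp
  note sum = this
  have "(cmod (\<Sum>\<xi>\<in>S. c \<xi> * \<xi> x))\<^sup>2 \<le> 2 ^ (n + 1)" for x
    unfolding sum[of x, symmetric] by simp
  then have "cmod (\<Sum>\<xi>\<in>S. c \<xi> * \<xi> x) \<le> sqrt (2 ^ (n + 1))" for x :: 'a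
    by (intro real_le_rsqrt)
  with Scd show ?thesis by (intro exI[of _ S] exI[of _ c]) simp
qed

section \<open>Complex Borel measures and their atoms\<close>

definition countably_additive_real :: "('a::topological_space set \<Rightarrow> real) \<Rightarrow> bool" where
  "countably_additive_real \<nu> \<longleftrightarrow> (\<forall>A :: nat \<Rightarrow> 'a set. range A \<subseteq> sets borel \<longrightarrow> disjoint_family A \<longrightarrow>
     (\<lambda>i. \<nu> (A i)) sums \<nu> (\<Union>i. A i))"

lemma countably_additive_real_empty:
  assumes "countably_additive_real \<nu>"
  shows "\<nu> {} = 0"
proof -
  have "(\<lambda>i::nat. \<nu> {}) sums \<nu> (\<Union>i::nat. {})"
    using assms[unfolded countably_additive_real_def, rule_format, of "\<lambda>_. {}"]
    by (simp add: disjoint_family_on_def)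
  then have "summable (\<lambda>i::nat. \<nu> {})" by (rule sums_summable)
  then show ?thesis by (simp add: summable_const_iff)
qed

lemma countably_additive_real_Un:
  assumes "countably_additive_real \<nu>" "A \<in> sets borel" "B \<in> sets borel" "A \<inter> B = {}"
  shows "\<nu> (A \<union> B) = \<nu> A + \<nu> B"
proof -
  have "range (binaryset A B) \<subseteq> sets borel" "disjoint_family (binaryset A B)"
    using assms(2-4) by (auto simp: disjoint_family_on_def binaryset_def)
  then have "(\<lambda>i. \<nu> (binaryset A B i)) sums \<nu> (A \<union> B)"
    using assms(1) unfolding countably_additive_real_def UN_binaryset_eq[symmetric] by blast
  moreover have "(\<lambda>i. \<nu> (binaryset A B i)) sums (\<nu> A + \<nu> B)"
    using countably_additive_real_empty[OF assms(1)] by (rule binaryset_sums)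
  ultimately show ?thesis by (rule sums_unique2)
qed

lemma sets_positive_part [simp]: "sets (positive_part \<nu>) = sets borel"
  and space_positive_part [simp]: "space (positive_part \<nu>) = UNIV"
  unfolding positive_part_def using sets.sigma_sets_eq[of borel]
  by (auto simp: sets_measure_of_conv space_measure_of_conv)

text \<open>\<open>measure_of\<close> returns the given set function only if that is a measure, so
  the supremum must be shown countably additive. One inequality comes from finite superadditivity;
  for the other, each competitor \<open>B\<close> is cut along the sets \<open>A i\<close>.\<close>

lemma emeasure_positive_part:
  fixes \<nu> :: "'a::topological_space set \<Rightarrow> real"
  assumes \<nu>: "countably_additive_real \<nu>" and E: "E \<in> sets borel"
  shows "emeasure (positive_part \<nu>) E = (SUP A\<in>{A \<in> sets borel. A \<subseteq> E}. ennreal (\<nu> A))"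
proof -
  let ?p = "\<lambda>E. SUP A\<in>{A \<in> sets borel. A \<subseteq> E}. ennreal (\<nu> A)"
  have pos: "positive (sets borel) ?p"
    using countably_additive_real_empty[OF \<nu>] by (auto simp: positive_def intro!: SUP_eq_const)
  have mono: "?p E \<le> ?p F" if "E \<subseteq> F" for E F
    using that by (intro SUP_subset_mono) auto
  have superadd: "?p E + ?p F \<le> ?p (E \<union> F)" if "E \<inter> F = {}" for E F
  proof -
    have "?p E + ?p F = (SUP A\<in>{A \<in> sets borel. A \<subseteq> E}. SUP B\<in>{A \<in> sets borel. A \<subseteq> F}. ennreal (\<nu> A) + ennreal (\<nu> B))"
      by (subst ennreal_SUP_add_right[symmetric] ennreal_SUP_add_left[symmetric], blast)+ simp
    also have "\<dots> \<le> ?p (E \<union> F)"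
    proof (intro SUP_least)
      fix A B assume A: "A \<in> {A \<in> sets borel. A \<subseteq> E}" and B: "B \<in> {A \<in> sets borel. A \<subseteq> F}"
      \<comment> \<open>The cut-off at 0 forces a case split: if one value is not positive, the
        other set alone is a competitor.\<close>
      have "\<exists>C\<in>{C \<in> sets borel. C \<subseteq> E \<union> F}. ennreal (\<nu> A) + ennreal (\<nu> B) \<le> ennreal (\<nu> C)"
      proof (cases "\<nu> A \<le> 0 \<or> \<nu> B \<le> 0")
        case True
        then show ?thesis
          using A B by (elim disjE; intro bexI[of _ "if \<nu> A \<le> 0 then B else A"]) (auto simp: ennreal_neg)
      next
        case False
        have "\<nu> (A \<union> B) = \<nu> A + \<nu> B"
          using A B that by (intro countably_additive_real_Un[OF \<nu>]) auto
        with False A B show ?thesis by (intro bexI[of _ "A \<union> B"]) (auto simp: ennreal_plus)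
      qed
      then show "ennreal (\<nu> A) + ennreal (\<nu> B) \<le> ?p (E \<union> F)"
        by (meson SUP_upper2)
    qed
    finally show ?thesis .
  qed
  have "countably_additive (sets borel) ?p"
  proof (rule countably_additiveI)
    fix A :: "nat \<Rightarrow> 'a set"
    assume A: "range A \<subseteq> sets borel" "disjoint_family A" "\<Union> (range A) \<in> sets borel"
    have fin: "(\<Sum>i<n. ?p (A i)) \<le> ?p (\<Union>i<n. A i)" for n
    proof (induction n)
      case (Suc n)
      have "A i \<inter> A n = {}" if "i < n" for i
        using A(2) that disjoint_family_onD[of A UNIV i n] by simp
      then have "(\<Union>i<n. A i) \<inter> A n = {}" by blast
      have "(\<Sum>i<Suc n. ?p (A i)) \<le> ?p (\<Union>i<n. A i) + ?p (A n)" using Suc by (simp add: add_right_mono)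
      also have "\<dots> \<le> ?p ((\<Union>i<n. A i) \<union> A n)" using \<open>_ \<inter> A n = {}\<close> by (rule superadd)
      also have "(\<Union>i<n. A i) \<union> A n = (\<Union>i<Suc n. A i)" by (auto simp: lessThan_Suc)
      finally show ?case .
    qed simp
    show "(\<Sum>i. ?p (A i)) = ?p (\<Union> (range A))"
    proof (rule antisym)
      have "(\<Sum>i<n. ?p (A i)) \<le> ?p (\<Union> (range A))" for n
        using fin[of n] mono[of "\<Union>i<n. A i" "\<Union> (range A)"] by (rule order_trans) blast
      then show "(\<Sum>i. ?p (A i)) \<le> ?p (\<Union> (range A))" by (intro suminf_le_const) auto
      show "?p (\<Union> (range A)) \<le> (\<Sum>i. ?p (A i))"
      proof (rule SUP_least)
        fix B assume B: "B \<in> {B \<in> sets borel. B \<subseteq> \<Union> (range A)}"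
        have "(\<lambda>i. \<nu> (B \<inter> A i)) sums \<nu> (\<Union>i. B \<inter> A i)"
          using \<nu>[unfolded countably_additive_real_def, rule_format, of "\<lambda>i. B \<inter> A i"] A(1,2) B
          by (auto simp: disjoint_family_on_def)
        moreover have "(\<Union>i. B \<inter> A i) = B" using B by blast
        ultimately have "(\<lambda>n. \<Sum>i<n. \<nu> (B \<inter> A i)) \<longlonglongrightarrow> \<nu> B" by (simp add: sums_def)
        then have "(\<lambda>n. ennreal (\<Sum>i<n. \<nu> (B \<inter> A i))) \<longlonglongrightarrow> ennreal (\<nu> B)" by (rule tendsto_ennrealI)
        moreover have "ennreal (\<Sum>i<n. \<nu> (B \<inter> A i)) \<le> (\<Sum>i. ?p (A i))" for n
        proof -
          have "ennreal (\<Sum>i<n. \<nu> (B \<inter> A i)) \<le> ennreal (\<Sum>i<n. max 0 (\<nu> (B \<inter> A i)))"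
            by (intro ennreal_leI sum_mono) simp
          also have "\<dots> = (\<Sum>i<n. ennreal (max 0 (\<nu> (B \<inter> A i))))"
            by (rule sum_ennreal[symmetric]) simp
          also have "\<dots> = (\<Sum>i<n. ennreal (\<nu> (B \<inter> A i)))"
            by (intro sum.cong) (auto simp: max_def ennreal_neg)
          also have "\<dots> \<le> (\<Sum>i<n. ?p (A i))"
            using A(1) B by (intro sum_mono SUP_upper) auto
          also have "\<dots> \<le> (\<Sum>i. ?p (A i))" by (intro sum_le_suminf) auto
          finally show ?thesis .
        qed
        ultimately show "ennreal (\<nu> B) \<le> (\<Sum>i. ?p (A i))" by (intro LIMSEQ_le_const2) auto
      qed
    qed
  qed
  with pos show ?thesis
    unfolding positive_part_def using E sets.sigma_algebra_axioms[of "borel :: 'a measure"]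
    by (intro emeasure_measure_of_sigma) auto
qed

lemma complex_borel_measure_parts:
  assumes "complex_borel_measure \<mu>"
  shows "countably_additive_real (\<lambda>E. Re (\<mu> E))" "countably_additive_real (\<lambda>E. - Re (\<mu> E))"
    "countably_additive_real (\<lambda>E. Im (\<mu> E))" "countably_additive_real (\<lambda>E. - Im (\<mu> E))"
  using assms unfolding complex_borel_measure_def countably_additive_real_def
  by (auto intro!: sums_Re sums_Im sums_minus)

lemma complex_borel_measure_empty:
  assumes "complex_borel_measure \<mu>" shows "\<mu> {} = 0"
  using complex_borel_measure_parts[OF assms, THEN countably_additive_real_empty]
  by (simp add: complex_eq_iff)

text \<open>The family becomes a partition of \<open>E\<close> once the remainder is added, which
  can only increase the sum; an empty remainder is dropped because blocks of a partition are
  nonempty.\<close>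

lemma sum_le_total_variation:
  fixes \<mu> :: "'a::topological_space set \<Rightarrow> complex"
  assumes E: "E \<in> sets borel" and P: "finite P" "P \<subseteq> sets borel" "\<Union>P \<subseteq> E" "disjoint P" "{} \<notin> P"
  shows "(\<Sum>A\<in>P. ennreal (cmod (\<mu> A))) \<le> total_variation \<mu> E"
proof -
  let ?Q = "P \<union> ({E - \<Union>P} - {{}})"
  have "\<Union>P \<in> sets borel" using P by (intro sets.finite_Union) auto
  then have "?Q \<subseteq> sets borel" using E P by auto
  moreover have "partition_on E ?Q"
    using P(3-5) by (auto simp: partition_on_def disjoint_def)
  ultimately have "(\<Sum>A\<in>?Q. ennreal (cmod (\<mu> A))) \<le> total_variation \<mu> E"
    unfolding total_variation_def using P(1) by (intro SUP_upper) auto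
  moreover have "(\<Sum>A\<in>P. ennreal (cmod (\<mu> A))) \<le> (\<Sum>A\<in>?Q. ennreal (cmod (\<mu> A)))"
    using P(1) by (intro sum_mono2) auto
  ultimately show ?thesis by (rule order_trans[rotated])
qed

lemma sum_singletons_le_total_variation:
  fixes \<mu> :: "'a::t1_space set \<Rightarrow> complex"
  assumes "finite F" "F \<subseteq> E" "E \<in> sets borel"
  shows "ennreal (\<Sum>x\<in>F. cmod (\<mu> {x})) \<le> total_variation \<mu> E"
proof -
  have "ennreal (\<Sum>x\<in>F. cmod (\<mu> {x})) = (\<Sum>A\<in>(\<lambda>x. {x}) ` F. ennreal (cmod (\<mu> A)))"
    by (subst sum.reindex) (auto simp: sum_ennreal)
  also have "\<dots> \<le> total_variation \<mu> E"
    using assms by (intro sum_le_total_variation) (auto simp: disjoint_def)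
  finally show ?thesis .
qed

lemma cmod_le_total_variation:
  assumes "complex_borel_measure \<mu>" "A \<in> sets borel"
  shows "ennreal (cmod (\<mu> A)) \<le> total_variation \<mu> UNIV"
  using sum_le_total_variation[of UNIV "{A}" \<mu>] assms(2) complex_borel_measure_empty[OF assms(1)]
  by (cases "A = {}") auto

lemma finite_measure_parts:
  assumes \<mu>: "complex_borel_measure \<mu>" "total_variation \<mu> UNIV < \<infinity>"
  shows "finite_measure (positive_part (\<lambda>E. Re (\<mu> E)))" "finite_measure (positive_part (\<lambda>E. - Re (\<mu> E)))"
    "finite_measure (positive_part (\<lambda>E. Im (\<mu> E)))" "finite_measure (positive_part (\<lambda>E. - Im (\<mu> E)))"
proof -
  have *: "finite_measure (positive_part \<nu>)"
    if "countably_additive_real \<nu>" and le: "\<And>E. \<nu> E \<le> cmod (\<mu> E)" for \<nu>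
  proof
    have "emeasure (positive_part \<nu>) UNIV \<le> total_variation \<mu> UNIV"
      using order_trans[OF ennreal_leI[OF le] cmod_le_total_variation[OF \<mu>(1)]]
      by (subst emeasure_positive_part[OF that(1)]) (auto intro!: SUP_least)
    then show "emeasure (positive_part \<nu>) (space (positive_part \<nu>)) \<noteq> \<infinity>" using \<mu>(2) by auto
  qed
  show "finite_measure (positive_part (\<lambda>E. Re (\<mu> E)))" "finite_measure (positive_part (\<lambda>E. - Re (\<mu> E)))"
    "finite_measure (positive_part (\<lambda>E. Im (\<mu> E)))" "finite_measure (positive_part (\<lambda>E. - Im (\<mu> E)))"
    using abs_Re_le_cmod[of "\<mu> _"] abs_Im_le_cmod[of "\<mu> _"]
    by (intro * complex_borel_measure_parts \<mu>(1); simp add: abs_le_iff)+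
qed

lemma measure_positive_part_singleton:
  fixes \<nu> :: "'a::t1_space set \<Rightarrow> real"
  assumes "countably_additive_real \<nu>"
  shows "measure (positive_part \<nu>) {x} = max 0 (\<nu> {x})"
proof -
  have "emeasure (positive_part \<nu>) {x} = (SUP A\<in>{{}, {x}}. ennreal (\<nu> A))"
  proof -
    have "{A \<in> sets borel. A \<subseteq> {x}} = {{}, {x}}" by auto
    then show ?thesis by (simp add: emeasure_positive_part[OF assms])
  qed
  also have "\<dots> = ennreal (max 0 (\<nu> {x}))"
    using countably_additive_real_empty[OF assms] by (auto simp add: max_def ennreal_neg sup_max bot_ennreal)
  finally show ?thesis by (simp add: measure_def)
qed

text \<open>A function is a uniform limit of its restrictions to finite sets if it vanishes at infinity
  for the discrete topology.\<close>

lemma has_sum_integral_atoms: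
  fixes f :: "'a::t1_space \<Rightarrow> complex"
  assumes M: "finite_measure M" "sets M = sets borel"
    and f: "\<And>e. e > 0 \<Longrightarrow> finite {x. e \<le> cmod (f x)}"
  shows "((\<lambda>x. measure M {x} * f x) has_sum integral\<^sup>L M f) UNIV"
proof -
  interpret finite_measure M by fact
  have space: "space M = UNIV" using sets_eq_imp_space_eq[OF M(2)] by simp
  \<comment> \<open>The support is a countable union of finite sets. As singletons are closed, a
    function with countable support is Borel measurable.\<close>
  have "countable (\<Union>n. {x. inverse (real (Suc n)) \<le> cmod (f x)})"
    using f by (intro countable_UN) (auto intro: countable_finite)
  moreover have "{x. f x \<noteq> 0} \<subseteq> (\<Union>n. {x. inverse (real (Suc n)) \<le> cmod (f x)})"
  proof
    fix x assume "x \<in> {x. f x \<noteq> 0}"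
    then have "0 < cmod (f x)" by simp
    then obtain n where "inverse (real (Suc n)) < cmod (f x)" using reals_Archimedean by blast
    then have "x \<in> {x. inverse (real (Suc n)) \<le> cmod (f x)}" by simp
    then show "x \<in> (\<Union>n. {x. inverse (real (Suc n)) \<le> cmod (f x)})" by (rule UN_I[OF UNIV_I])
  qed
  ultimately have "countable {x. f x \<noteq> 0}" by (rule countable_subset[rotated])
  then have meas: "f \<in> borel_measurable M"
    by (rule measurable_discrete_difference[where f = "\<lambda>_. 0" and X = "{x. f x \<noteq> 0}", rotated]) (simp_all add: M(2))
  define B where "B = Max (insert 1 ((\<lambda>x. cmod (f x)) ` {x. 1 \<le> cmod (f x)}))"
  have "cmod (f x) \<le> B" for x
  proof (cases "1 \<le> cmod (f x)")
    case True then show ?thesis unfolding B_def using f[of 1] by (intro Max_ge) auto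
  next
    case False
    have "1 \<le> B" unfolding B_def using f[of 1] by (intro Max_ge) auto
    with False show ?thesis by simp
  qed
  then have int: "integrable M f" using meas by (intro integrable_const_bound[where B = B]) auto
  have fin_int: "integrable M (\<lambda>y. \<Sum>x\<in>F. indicator {x} y *\<^sub>R f x)"
    "(\<integral>y. (\<Sum>x\<in>F. indicator {x} y *\<^sub>R f x) \<partial>M) = (\<Sum>x\<in>F. measure M {x} * f x)" if "finite F" for F
    by (auto simp: M(2) space scaleR_conv_of_real less_top[symmetric])
  have "(sum (\<lambda>x. measure M {x} * f x) \<longlongrightarrow> integral\<^sup>L M f) (finite_subsets_at_top UNIV)"
  proof (rule tendstoI)
    fix e :: real assume e: "e > 0"
    \<comment> \<open>A uniform error of \<open>d\<close>, integrated over the total mass, stays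
      below \<open>e\<close>; the summand 1 covers the zero measure.\<close>
    define d where "d = e / (measure M UNIV + 1)"
    have d: "d > 0" using e by (simp add: d_def add_nonneg_pos)
    have close: "dist (\<Sum>x\<in>F. measure M {x} * f x) (integral\<^sup>L M f) < e"
      if F: "finite F" "{x. d \<le> cmod (f x)} \<subseteq> F" for F
    proof -
      have "norm ((\<integral>y. f y - (\<Sum>x\<in>F. indicator {x} y *\<^sub>R f x) \<partial>M)) \<le> (\<integral>y. d \<partial>M)"
      proof (rule order_trans[OF integral_norm_bound], rule integral_mono)
        show "integrable M (\<lambda>y. norm (f y - (\<Sum>x\<in>F. indicator {x} y *\<^sub>R f x)))"
          using int fin_int(1)[OF F(1)] by auto
        fix y
        have "(\<Sum>x\<in>F. indicator {x} y *\<^sub>R f x) = (\<Sum>x\<in>F. if x = y then f x else 0)"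
          by (intro sum.cong) (auto simp: indicator_def)
        also have "\<dots> = (if y \<in> F then f y else 0)" using F(1) by simp
        finally show "norm (f y - (\<Sum>x\<in>F. indicator {x} y *\<^sub>R f x)) \<le> d"
          using F(2) d linear[of d "cmod (f y)"] by (cases "y \<in> F") auto
      qed auto
      also have "\<dots> < e"
      proof -
        have "measure M UNIV * e < e * (measure M UNIV + 1)" using e by (simp add: algebra_simps)
        moreover have "0 < measure M UNIV + 1" by (simp add: add_nonneg_pos)
        ultimately show ?thesis by (simp add: d_def space pos_divide_less_eq)
      qed
      finally show ?thesis
        using int fin_int[OF F(1)] by (simp add: dist_norm norm_minus_commute)
    qed
    show "\<forall>\<^sub>F F in finite_subsets_at_top UNIV. dist (\<Sum>x\<in>F. measure M {x} * f x) (integral\<^sup>L M f) < e"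
      unfolding eventually_finite_subsets_at_top using f[OF d] close by blast
  qed
  then show ?thesis by (simp add: has_sum_def)
qed

text \<open>The diffuse part of \<open>\<mu>\<close> does not see such an \<open>f\<close>. Applied
  to the integrand of a convolution, this takes the place of Fubini on a product measure.\<close>

lemma has_sum_complex_integral:
  fixes f :: "'a::t1_space \<Rightarrow> complex"
  assumes \<mu>: "complex_borel_measure \<mu>" "total_variation \<mu> UNIV < \<infinity>"
    and f: "\<And>e. e > 0 \<Longrightarrow> finite {x. e \<le> cmod (f x)}"
  shows "((\<lambda>x. \<mu> {x} * f x) has_sum complex_integral \<mu> f) UNIV"
proof -
  note parts = complex_borel_measure_parts[OF \<mu>(1)]
  have atoms: "((\<lambda>x. complex_of_real (max 0 (\<nu> {x})) * f x) has_sum integral\<^sup>L (positive_part \<nu>) f) UNIV"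
    if "countably_additive_real \<nu>" "finite_measure (positive_part \<nu>)" for \<nu>
    using has_sum_integral_atoms[OF that(2) sets_positive_part f]
    by (simp add: measure_positive_part_singleton[OF that(1)])
  note A = parts(1)[THEN atoms, OF finite_measure_parts(1)[OF \<mu>]]
    parts(2)[THEN atoms, OF finite_measure_parts(2)[OF \<mu>]]
    parts(3)[THEN atoms, OF finite_measure_parts(3)[OF \<mu>]]
    parts(4)[THEN atoms, OF finite_measure_parts(4)[OF \<mu>]]
  have split: "(complex_of_real (max 0 (Re z)) * w + - (complex_of_real (max 0 (- Re z)) * w)) +
     \<i> * (complex_of_real (max 0 (Im z)) * w + - (complex_of_real (max 0 (- Im z)) * w)) = z * w" for z w
    by (simp add: complex_eq_iff max_def algebra_simps)
  have neg: "((\<lambda>x. - g x) has_sum - a) UNIV" if "(g has_sum a) UNIV" for g :: "'a \<Rightarrow> complex" and a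
    using that by (simp add: has_sum_uminus)
  have "((\<lambda>x. \<mu> {x} * f x) has_sum
    (integral\<^sup>L (positive_part (\<lambda>E. Re (\<mu> E))) f + - integral\<^sup>L (positive_part (\<lambda>E. - Re (\<mu> E))) f) +
    \<i> * (integral\<^sup>L (positive_part (\<lambda>E. Im (\<mu> E))) f + - integral\<^sup>L (positive_part (\<lambda>E. - Im (\<mu> E))) f)) UNIV"
    using has_sum_add[OF has_sum_add[OF A(1) neg[OF A(2)]]
        has_sum_cmult_right[OF has_sum_add[OF A(3) neg[OF A(4)]], of \<i>]]
    unfolding split .
  then show ?thesis by (simp add: complex_integral_def)
qed

section \<open>Finitely supported measures\<close>

text \<open>Serves both directions: point masses tell atomic characters apart on any group, and with
  \<open>F = UNIV\<close> these are all the measures on a finite group.\<close>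

definition finsupp_measure :: "'a::topological_space set \<Rightarrow> ('a \<Rightarrow> complex) \<Rightarrow> 'a set \<Rightarrow> complex" where
  "finsupp_measure F m E = (if E \<in> sets borel then \<Sum>x\<in>F \<inter> E. m x else 0)"

lemma finsupp_measure_eq:
  "finite F \<Longrightarrow> E \<in> sets borel \<Longrightarrow> finsupp_measure F m E = (\<Sum>x\<in>F. indicator E x * m x)"
  by (auto simp: finsupp_measure_def sum.inter_restrict indicator_def intro!: sum.cong)

lemma finsupp_measure_singleton:
  fixes F :: "'a::t1_space set"
  shows "finsupp_measure F m {x} = (if x \<in> F then m x else 0)"
  by (auto simp: finsupp_measure_def Int_insert_right)

lemma complex_borel_measure_finsupp:
  assumes "finite F"
  shows "complex_borel_measure (finsupp_measure F m)"
  unfolding complex_borel_measure_def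
proof (intro conjI allI impI)
  show "finsupp_measure F m E = 0" if "E \<notin> sets borel" for E
    using that by (simp add: finsupp_measure_def)
  fix A :: "nat \<Rightarrow> 'a set"
  assume A: "range A \<subseteq> sets borel" "disjoint_family A"
  have "(\<lambda>i. indicator (A i) x * m x) sums (indicator (\<Union>i. A i) x * m x)" for x
  proof (cases "\<exists>n. x \<in> A n")
    case True
    then obtain n where n: "x \<in> A n" by blast
    have "(\<lambda>i. indicator (A i) x * m x) sums (\<Sum>i\<in>{n}. indicator (A i) x * m x)"
    proof (rule sums_finite)
      fix i assume "i \<notin> {n}"
      then have "A i \<inter> A n = {}" using disjoint_family_onD[OF A(2)] by simp
      then show "indicator (A i) x * m x = 0" using n by (auto simp: indicator_def)
    qed simp
    then show ?thesis using n by (auto simp: indicator_def)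
  qed (auto simp: indicator_def)
  then have "(\<lambda>i. \<Sum>x\<in>F. indicator (A i) x * m x) sums (\<Sum>x\<in>F. indicator (\<Union>i. A i) x * m x)"
    by (intro sums_sum)
  moreover have "(\<Union>i. A i) \<in> sets borel" using A(1) by (intro sets.countable_UN) auto
  ultimately show "(\<lambda>i. finsupp_measure F m (A i)) sums finsupp_measure F m (\<Union>i. A i)"
    using A(1) by (simp add: finsupp_measure_eq[OF assms] range_subsetD)
qed

lemma total_variation_finsupp:
  fixes F :: "'a::t1_space set"
  assumes F: "finite F" and E: "E \<in> sets borel"
  shows "total_variation (finsupp_measure F m) E = ennreal (\<Sum>x\<in>F \<inter> E. cmod (m x))"
proof (rule antisym)
  have "(\<Sum>x\<in>F \<inter> E. cmod (m x)) = (\<Sum>x\<in>F \<inter> E. cmod (finsupp_measure F m {x}))"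
    by (simp add: finsupp_measure_singleton)
  then show "ennreal (\<Sum>x\<in>F \<inter> E. cmod (m x)) \<le> total_variation (finsupp_measure F m) E"
    using sum_singletons_le_total_variation[of "F \<inter> E" E] F E by simp
  show "total_variation (finsupp_measure F m) E \<le> ennreal (\<Sum>x\<in>F \<inter> E. cmod (m x))"
    unfolding total_variation_def
  proof (rule SUP_least)
    fix P assume "P \<in> {P. finite P \<and> P \<subseteq> sets borel \<and> partition_on E P}"
    then have P: "finite P" "P \<subseteq> sets borel" "partition_on E P" by auto
    have "(\<Sum>A\<in>P. ennreal (cmod (finsupp_measure F m A))) = ennreal (\<Sum>A\<in>P. cmod (finsupp_measure F m A))"
      by simp
    also have "\<dots> \<le> ennreal (\<Sum>A\<in>P. \<Sum>x\<in>F \<inter> A. cmod (m x))"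
      using P(2) by (intro ennreal_leI sum_mono) (auto simp: finsupp_measure_def intro: norm_sum)
    also have "(\<Sum>A\<in>P. \<Sum>x\<in>F \<inter> A. cmod (m x)) = (\<Sum>x\<in>(\<Union>A\<in>P. F \<inter> A). cmod (m x))"
      using P F by (intro sum.UNION_disjoint[symmetric]) (auto simp: partition_on_def disjoint_def)
    also have "(\<Union>A\<in>P. F \<inter> A) = F \<inter> E"
      using P(3) by (auto simp: partition_on_def)
    finally show "(\<Sum>A\<in>P. ennreal (cmod (finsupp_measure F m A))) \<le> ennreal (\<Sum>x\<in>F \<inter> E. cmod (m x))" .
  qed
qed

text \<open>The infimum and the supremum are attained: the complement of the finite set
  \<open>F - E\<close> is open and carries the same mass as \<open>E\<close>, and so does the
  compact set \<open>F \<inter> E\<close>.\<close>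

lemma finsupp_measure_bounded_regular:
  fixes F :: "'a::t2_space set"
  assumes F: "finite F"
  shows "finsupp_measure F m \<in> bounded_regular_measures"
proof -
  let ?t = "total_variation (finsupp_measure F m)"
  have mono: "?t A \<le> ?t B" if "A \<subseteq> B" "A \<in> sets borel" "B \<in> sets borel" for A B
    using that F by (auto simp: total_variation_finsupp[OF F] intro!: ennreal_leI sum_mono2)
  have eq: "?t A = ?t B" if "F \<inter> A = F \<inter> B" "A \<in> sets borel" "B \<in> sets borel" for A B
    using that by (simp add: total_variation_finsupp[OF F])
  have "regular_measure (finsupp_measure F m)"
    unfolding regular_measure_def
  proof (intro ballI conjI antisym)
    fix E :: "'a set" assume E: "E \<in> sets borel"
    show "?t E \<le> (INF U\<in>{U. open U \<and> E \<subseteq> U}. ?t U)"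
      using E by (intro INF_greatest mono) auto
    have U: "open (- (F - E))" using F by (intro open_Compl finite_imp_closed) auto
    then have "(INF U\<in>{U. open U \<and> E \<subseteq> U}. ?t U) \<le> ?t (- (F - E))"
      by (intro INF_lower) auto
    also have "\<dots> = ?t E" using E U by (intro eq) auto
    finally show "(INF U\<in>{U. open U \<and> E \<subseteq> U}. ?t U) \<le> ?t E" .
    have K: "F \<inter> E \<in> sets borel" using F by (intro borel_closed finite_imp_closed) auto
    show "(SUP K\<in>{K. compact K \<and> K \<subseteq> E}. ?t K) \<le> ?t E"
    proof (rule SUP_least)
      fix K assume K: "K \<in> {K. compact K \<and> K \<subseteq> E}"
      with E show "?t K \<le> ?t E" by (intro mono) (auto intro: borel_closed compact_imp_closed)
    qed
    have "?t E = ?t (F \<inter> E)" using E K by (intro eq) auto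
    also have "\<dots> \<le> (SUP K\<in>{K. compact K \<and> K \<subseteq> E}. ?t K)"
      using F by (intro SUP_upper) (auto intro: finite_imp_compact)
    finally show "?t E \<le> (SUP K\<in>{K. compact K \<and> K \<subseteq> E}. ?t K)" .
  qed
  then show ?thesis
    using F by (auto simp: bounded_regular_measures_def complex_borel_measure_finsupp total_variation_finsupp)
qed

text \<open>As the pushforward of a weighted counting measure on \<open>F\<close>, the variation
  makes integrability of any measurable function a finite matter.\<close>

lemma variation_measure_finsupp:
  fixes F :: "'a::t1_space set"
  assumes F: "finite F"
  shows "variation_measure (finsupp_measure F m) =
    distr (point_measure F (\<lambda>x. ennreal (cmod (m x)))) borel (\<lambda>x. x)" (is "_ = ?N")
proof -
  have "emeasure ?N E = total_variation (finsupp_measure F m) E" if "E \<in> sets borel" for E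
  proof -
    have "emeasure ?N E = (\<Sum>x\<in>F \<inter> E. ennreal (cmod (m x)))"
      using that F by (subst emeasure_distr) (auto simp: space_point_measure emeasure_point_measure_finite Int_commute)
    then show ?thesis using that F by (simp add: total_variation_finsupp)
  qed
  then have "variation_measure (finsupp_measure F m) = measure_of (space ?N) (sets ?N) (emeasure ?N)"
    unfolding variation_measure_def
    by (auto simp: sets.sigma_sets_eq[of borel, simplified] intro!: measure_of_eq)
  then show ?thesis by (simp only: measure_of_of_measure)
qed

lemma integrable_variation_finsupp:
  fixes F :: "'a::t1_space set" and f :: "'a \<Rightarrow> real"
  assumes "finite F" "f \<in> borel_measurable borel"
  shows "integrable (variation_measure (finsupp_measure F m)) f"
  unfolding variation_measure_finsupp[OF assms(1)]
  using assms by (subst integrable_distr_eq) (auto simp: integrable_point_measure_finite)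

text \<open>Here \<open>f\<close> may be large at infinitely many points. It is first cut down to
  \<open>F\<close>, which changes it only on a null set of each Jordan part; then the sum over atoms
  applies.\<close>

lemma complex_integral_finsupp:
  fixes F :: "'a::t1_space set"
  assumes F: "finite F" and f: "f \<in> borel_measurable borel"
  shows "complex_integral (finsupp_measure F m) f = (\<Sum>x\<in>F. m x * f x)"
proof -
  let ?\<mu> = "finsupp_measure F m"
  let ?g = "\<lambda>x. indicator F x * f x"
  note \<mu> = complex_borel_measure_finsupp[OF F, of m]
  have Fb: "F \<in> sets borel" using F by (intro borel_closed finite_imp_closed)
  have null: "\<mu>' A = 0" if "\<mu>' = ?\<mu>" "A \<subseteq> - F" for \<mu>' A
  proof -
    have "F \<inter> A = {}" using that(2) by blast
    then show ?thesis using that(1) by (simp add: finsupp_measure_def)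
  qed
  have same: "integral\<^sup>L (positive_part \<nu>) f = integral\<^sup>L (positive_part \<nu>) ?g"
    if \<nu>: "countably_additive_real \<nu>" and 0: "\<And>A. A \<subseteq> - F \<Longrightarrow> \<nu> A = 0" for \<nu>
  proof (rule integral_cong_AE)
    have "emeasure (positive_part \<nu>) (- F) = 0"
      using Fb 0 by (subst emeasure_positive_part[OF \<nu>]) (auto intro!: SUP_eq_const)
    then show "AE x in positive_part \<nu>. f x = ?g x"
      using Fb by (intro AE_I'[of "- F"]) (auto simp: null_sets_def)
  qed (use f Fb in \<open>auto simp: measurable_cong_sets[OF sets_positive_part refl]\<close>)
  have "complex_integral ?\<mu> f = complex_integral ?\<mu> ?g"
    unfolding complex_integral_def using complex_borel_measure_parts[OF \<mu>]
    by (simp add: same null)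
  also have "\<dots> = (\<Sum>x\<in>F. m x * f x)"
  proof (rule has_sum_unique)
    have fin: "finite {x. e \<le> cmod (?g x)}" if "e > 0" for e
      using that by (intro finite_subset[OF _ F]) (auto simp: indicator_def split: if_splits)
    show "((\<lambda>x. ?\<mu> {x} * ?g x) has_sum complex_integral ?\<mu> ?g) UNIV"
      using F by (intro has_sum_complex_integral \<mu> fin) (simp_all add: total_variation_finsupp)
    show "((\<lambda>x. ?\<mu> {x} * ?g x) has_sum (\<Sum>x\<in>F. m x * f x)) UNIV"
      using F by (intro has_sum_finite_neutralI[of F]) (auto simp: finsupp_measure_singleton)
  qed
  finally show ?thesis .
qed

lemma weighted_measure_finsupp:
  fixes F :: "'a::t1_space set"
  assumes F: "finite F" and w: "w \<in> borel_measurable borel"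
  shows "weighted_measure w (finsupp_measure F m) = finsupp_measure F (\<lambda>x. w x * m x)"
proof
  fix E :: "'a set"
  show "weighted_measure w (finsupp_measure F m) E = finsupp_measure F (\<lambda>x. w x * m x) E"
    using F w by (auto simp: weighted_measure_def finsupp_measure_def complex_integral_finsupp
        sum.inter_restrict indicator_def mult.commute intro!: sum.cong)
qed

lemma finsupp_measure_carrier:
  fixes F :: "'a::{topological_ab_group_add, t2_space} set"
  assumes "finite F" "w \<in> borel_measurable borel"
  shows "finsupp_measure F m \<in> acarrier (weighted_measure_algebra w)"
  using assms by (simp add: weighted_measure_algebra_def finsupp_measure_bounded_regular
      integrable_variation_finsupp weighted_measure_finsupp)

lemma anorm_finsupp:
  fixes F :: "'a::{topological_ab_group_add, t2_space} set"
  assumes "finite F" "w \<in> borel_measurable borel" "\<And>x. 0 \<le> w x"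
  shows "anorm (weighted_measure_algebra w) (finsupp_measure F m) = (\<Sum>x\<in>F. w x * cmod (m x))"
  using assms by (simp add: weighted_measure_algebra_def weighted_measure_finsupp total_variation_finsupp
      norm_mult sum_nonneg)

section \<open>Failure of the BSE property\<close>

lemma continuous_map_gelfand_eval:
  "b \<in> acarrier B \<Longrightarrow> continuous_map (gelfand_topology B) euclidean (\<lambda>\<phi>. \<phi> b)"
  unfolding gelfand_topology_def
  by (rule continuous_map_from_subtopology, rule continuous_map_product_projection[where X = "\<lambda>_. euclidean"])

lemma character_space_extensional: "character_space B \<subseteq> extensional (acarrier B)"
  by (auto simp: character_space_def)

lemma topspace_gelfand: "topspace (gelfand_topology B) = character_space B"
  using character_space_extensional[of B] by (auto simp: gelfand_topology_def PiE_def)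

lemma character_space_neq:
  assumes "\<phi> \<in> character_space B" "\<psi> \<in> character_space B" "\<phi> \<noteq> \<psi>"
  shows "\<exists>b\<in>acarrier B. \<phi> b \<noteq> \<psi> b"
  using assms character_space_extensional[of B] by (meson extensionalityI subsetD)

text \<open>Distinct characters differ at some element \<open>b\<close>, and evaluation at
  \<open>b\<close> is Gelfand continuous. The bump is the product of the distances to the other
  values, normalised at \<open>\<phi>\<close>.\<close>

lemma gelfand_bump:
  assumes \<Phi>: "finite \<Phi>" "\<Phi> \<subseteq> character_space B" and \<phi>: "\<phi> \<in> character_space B"
  shows "\<exists>f. continuous_map (gelfand_topology B) euclideanreal f \<and> f \<phi> = 1 \<and> (\<forall>\<psi>\<in>\<Phi> - {\<phi>}. f \<psi> = 0)"
proof -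
  have "\<forall>\<psi>\<in>\<Phi> - {\<phi>}. \<exists>b\<in>acarrier B. \<phi> b \<noteq> \<psi> b"
    using assms character_space_neq by blast
  then obtain b where b: "\<And>\<psi>. \<psi> \<in> \<Phi> - {\<phi>} \<Longrightarrow> b \<psi> \<in> acarrier B \<and> \<phi> (b \<psi>) \<noteq> \<psi> (b \<psi>)"
    by metis
  define f where "f \<theta> = (\<Prod>\<psi>\<in>\<Phi> - {\<phi>}. cmod (\<theta> (b \<psi>) - \<psi> (b \<psi>)) * (1 / cmod (\<phi> (b \<psi>) - \<psi> (b \<psi>))))" for \<theta>
  have "continuous_map (gelfand_topology B) euclideanreal f"
    unfolding f_def using \<Phi>(1) b
    by (intro continuous_map_prod continuous_map_real_mult_right continuous_map_norm continuous_map_diff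
        continuous_map_gelfand_eval) auto
  moreover have "f \<phi> = 1" unfolding f_def using b by (intro prod.neutral) auto
  moreover have "f \<psi> = 0" if "\<psi> \<in> \<Phi> - {\<phi>}" for \<psi>
    unfolding f_def using \<Phi>(1) that by (intro prod_zero bexI[of _ \<psi>]) auto
  ultimately show ?thesis by blast
qed

lemma gelfand_interpolation:
  assumes \<Phi>: "finite \<Phi>" "\<Phi> \<subseteq> character_space B" and c: "\<And>\<phi>. \<phi> \<in> \<Phi> \<Longrightarrow> \<bar>c \<phi>\<bar> \<le> 1"
  shows "\<exists>\<tau>. continuous_map (gelfand_topology B) euclideanreal \<tau> \<and> (\<forall>\<phi>. \<bar>\<tau> \<phi>\<bar> \<le> 1) \<and>
    (\<forall>\<phi>\<in>\<Phi>. \<tau> \<phi> = c \<phi>)"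
proof -
  have "\<forall>\<phi>\<in>\<Phi>. \<exists>f. continuous_map (gelfand_topology B) euclideanreal f \<and> f \<phi> = 1 \<and> (\<forall>\<psi>\<in>\<Phi> - {\<phi>}. f \<psi> = 0)"
    using gelfand_bump[OF \<Phi>] \<Phi>(2) by blast
  then obtain f where f: "\<And>\<phi>. \<phi> \<in> \<Phi> \<Longrightarrow> continuous_map (gelfand_topology B) euclideanreal (f \<phi>)"
    "\<And>\<phi>. \<phi> \<in> \<Phi> \<Longrightarrow> f \<phi> \<phi> = 1" "\<And>\<phi> \<psi>. \<phi> \<in> \<Phi> \<Longrightarrow> \<psi> \<in> \<Phi> \<Longrightarrow> \<psi> \<noteq> \<phi> \<Longrightarrow> f \<phi> \<psi> = 0"
    by (metis Diff_iff singletonD)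
  \<comment> \<open>Truncation to \<open>[-1, 1]\<close> keeps the prescribed values, which lie
    there already, and gives a bound independent of \<open>\<Phi>\<close>.\<close>
  define \<tau> where "\<tau> \<theta> = max (-1) (min 1 (\<Sum>\<phi>\<in>\<Phi>. c \<phi> * f \<phi> \<theta>))" for \<theta>
  have "continuous_map (gelfand_topology B) euclideanreal \<tau>"
    unfolding \<tau>_def using \<Phi>(1) f(1)
    by (intro continuous_map_real_max continuous_map_real_min continuous_map_sum continuous_map_real_mult_left) auto
  moreover have "\<bar>\<tau> \<theta>\<bar> \<le> 1" for \<theta> by (auto simp: \<tau>_def)
  moreover have "\<tau> \<psi> = c \<psi>" if "\<psi> \<in> \<Phi>" for \<psi>
  proof -
    have "(\<Sum>\<phi>\<in>\<Phi>. c \<phi> * f \<phi> \<psi>) = (\<Sum>\<phi>\<in>\<Phi>. if \<phi> = \<psi> then c \<psi> else 0)"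
      using f(2,3) that by (intro sum.cong) auto
    also have "\<dots> = c \<psi>" using \<Phi>(1) that by simp
    finally show ?thesis using c[OF that] by (simp add: \<tau>_def)
  qed
  ultimately show ?thesis by blast
qed

text \<open>Passes from finite sequences, in which characters may repeat, to finite sets, with one
  \<open>\<beta>\<close> for all of them.\<close>

lemma C_BSE_bound_finite:
  assumes \<sigma>: "\<sigma> \<in> C_BSE B"
  shows "\<exists>\<beta>>0. \<forall>\<Phi> c. finite \<Phi> \<longrightarrow> \<Phi> \<subseteq> character_space B \<longrightarrow>
    cmod (\<Sum>\<phi>\<in>\<Phi>. c \<phi> * \<sigma> \<phi>) \<le> \<beta> * dual_norm B (\<lambda>b. \<Sum>\<phi>\<in>\<Phi>. c \<phi> * \<phi> b)"
proof -
  obtain \<beta> where \<beta>: "\<beta> > 0" and bse: "\<And>n c \<phi>. (\<forall>j<n. \<phi> j \<in> character_space B) \<Longrightarrow>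
      cmod (\<Sum>j<n. c j * \<sigma> (\<phi> j)) \<le> \<beta> * dual_norm B (\<lambda>b. \<Sum>j<(n::nat). c j * \<phi> j b)"
    using \<sigma> unfolding C_BSE_def by blast
  show ?thesis
  proof (intro exI[of _ \<beta>] conjI \<beta> allI impI)
    fix \<Phi> and c :: "('a \<Rightarrow> complex) \<Rightarrow> complex"
    assume \<Phi>: "finite \<Phi>" "\<Phi> \<subseteq> character_space B"
    obtain h where h: "bij_betw h {0..<card \<Phi>} \<Phi>" using ex_bij_betw_nat_finite[OF \<Phi>(1)] by blast
    have sum: "(\<Sum>j<card \<Phi>. g (h j)) = (\<Sum>\<phi>\<in>\<Phi>. g \<phi>)" for g :: "_ \<Rightarrow> complex"
      using sum.reindex_bij_betw[OF h] by (simp add: atLeast0LessThan)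
    have "h j \<in> character_space B" if "j < card \<Phi>" for j
      using bij_betwE[OF h] \<Phi>(2) that by auto
    then have "cmod (\<Sum>j<card \<Phi>. c (h j) * \<sigma> (h j)) \<le> \<beta> * dual_norm B (\<lambda>b. \<Sum>j<card \<Phi>. c (h j) * h j b)"
      by (intro bse) blast
    then show "cmod (\<Sum>\<phi>\<in>\<Phi>. c \<phi> * \<sigma> \<phi>) \<le> \<beta> * dual_norm B (\<lambda>b. \<Sum>\<phi>\<in>\<Phi>. c \<phi> * \<phi> b)"
      unfolding sum[of "\<lambda>\<phi>. c \<phi> * \<sigma> \<phi>"] sum[of "\<lambda>\<phi>. c \<phi> * \<phi> b" for b] .
  qed
qed

text \<open>A single \<open>\<sigma>\<close> is the sum of signed terms \<open>t n\<close>, the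
  \<open>n\<close>-th of which follows the signs on a block of \<open>16 ^ n\<close> characters with
  amplitude \<open>1 / 3 ^ n\<close>. On that block the BSE inequality would give
  \<open>16 ^ n / (2 * 3 ^ n) \<le> \<beta> * 4 ^ n * sqrt 2\<close> for every
  \<open>n\<close>.\<close>

lemma C_BSE_neq_Cb:
  fixes \<Phi> :: "nat \<Rightarrow> ('b \<Rightarrow> complex) set" and c :: "nat \<Rightarrow> ('b \<Rightarrow> complex) \<Rightarrow> real"
  assumes \<Phi>: "\<And>n. finite (\<Phi> n)" "\<And>n. \<Phi> n \<subseteq> character_space B" "\<And>n. card (\<Phi> n) = 2 ^ n"
    and c: "\<And>n \<phi>. \<phi> \<in> \<Phi> n \<Longrightarrow> c n \<phi> \<in> {1, -1}"
    and small: "\<And>n. dual_norm B (\<lambda>b. \<Sum>\<phi>\<in>\<Phi> n. c n \<phi> * \<phi> b) \<le> sqrt (2 ^ (n + 1))"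
  shows "C_BSE B \<noteq> Cb_character_space B"
proof
  assume eq: "C_BSE B = Cb_character_space B"
  let ?X = "gelfand_topology B"
  have "\<exists>\<tau>. continuous_map ?X euclideanreal \<tau> \<and> (\<forall>\<phi>. \<bar>\<tau> \<phi>\<bar> \<le> 1) \<and> (\<forall>\<phi>\<in>\<Phi> n. \<tau> \<phi> = c n \<phi>)" for n
    using c[of _ n] by (intro gelfand_interpolation \<Phi>) force
  then obtain \<tau> where \<tau>: "\<And>n. continuous_map ?X euclideanreal (\<tau> n)" "\<And>n \<phi>. \<bar>\<tau> n \<phi>\<bar> \<le> 1"
    "\<And>n \<phi>. \<phi> \<in> \<Phi> n \<Longrightarrow> \<tau> n \<phi> = c n \<phi>"
    by metis
  \<comment> \<open>The index \<open>4 * n\<close> gives \<open>16 ^ n\<close> characters with dual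
    norm at most \<open>4 ^ n * sqrt 2\<close>. The amplitude base 3 is below the gap
    \<open>16 / 4\<close>, so the quotient still grows, and above 2, so all later amplitudes
    together stay below the current one.\<close>
  define L where "L n \<sigma> = (\<Sum>\<phi>\<in>\<Phi> (4 * n). c (4 * n) \<phi> * \<sigma> \<phi>)" for n and \<sigma> :: "_ \<Rightarrow> real"
  have L_add: "L n (\<lambda>\<phi>. f \<phi> + g \<phi>) = L n f + L n g" and L_diff: "L n (\<lambda>\<phi>. f \<phi> - g \<phi>) = L n f - L n g" for n f g
    by (simp_all add: L_def ring_distribs sum.distrib sum_subtractf)
  have L_le: "\<bar>L n \<sigma>\<bar> \<le> 16 ^ n * K" if "\<And>\<phi>. \<phi> \<in> \<Phi> (4 * n) \<Longrightarrow> \<bar>\<sigma> \<phi>\<bar> \<le> K" for n \<sigma> K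
  proof -
    have "\<bar>L n \<sigma>\<bar> \<le> (\<Sum>\<phi>\<in>\<Phi> (4 * n). \<bar>c (4 * n) \<phi> * \<sigma> \<phi>\<bar>)" unfolding L_def by (rule sum_abs)
    also have "\<dots> \<le> (\<Sum>\<phi>\<in>\<Phi> (4 * n). K)"
      using c[of _ "4 * n"] that by (intro sum_mono) (force simp: abs_mult)
    also have "\<dots> = 16 ^ n * K" by (simp add: \<Phi> power_mult)
    finally show ?thesis .
  qed
  define t where "t n = (\<lambda>\<phi>. \<tau> (4 * n) \<phi> / 3 ^ n)" for n :: nat
  have L_t: "L n (t n) = 16 ^ n / 3 ^ n" for n
  proof -
    have "L n (t n) = (\<Sum>\<phi>\<in>\<Phi> (4 * n). 1 / 3 ^ n)"
      unfolding L_def t_def using c[of _ "4 * n"] by (intro sum.cong) (force simp: \<tau>(3))+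
    also have "\<dots> = 16 ^ n / 3 ^ n" by (simp add: \<Phi> power_mult)
    finally show ?thesis .
  qed
  \<comment> \<open>The sign of the \<open>n\<close>-th term is chosen after the earlier terms are
    fixed, whatever these contribute to \<open>L n\<close>.\<close>
  define S where "S = rec_nat (\<lambda>_. 0 :: real) (\<lambda>n s. if 16 ^ n / 3 ^ n \<le> \<bar>L n (\<lambda>\<phi>. s \<phi> + t n \<phi>)\<bar>
     then (\<lambda>\<phi>. s \<phi> + t n \<phi>) else (\<lambda>\<phi>. s \<phi> - t n \<phi>))"
  have S0: "S 0 = (\<lambda>_. 0)" by (simp add: S_def)
  have S_Suc: "S (Suc n) = (if 16 ^ n / 3 ^ n \<le> \<bar>L n (\<lambda>\<phi>. S n \<phi> + t n \<phi>)\<bar>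
     then (\<lambda>\<phi>. S n \<phi> + t n \<phi>) else (\<lambda>\<phi>. S n \<phi> - t n \<phi>))" for n
    by (simp add: S_def)
  text \<open>One of the two signs works because
    \<open>max \<bar>x + y\<bar> \<bar>x - y\<bar> \<ge> \<bar>y\<bar>\<close>; this replaces an appeal to the uniform boundedness principle.\<close>
  have L_S: "16 ^ n / 3 ^ n \<le> \<bar>L n (S (Suc n))\<bar>" for n
  proof (cases "16 ^ n / 3 ^ n \<le> \<bar>L n (\<lambda>\<phi>. S n \<phi> + t n \<phi>)\<bar>")
    case False
    then have "S (Suc n) = (\<lambda>\<phi>. S n \<phi> - t n \<phi>)" by (simp add: S_Suc)
    then have "L n (S (Suc n)) = L n (S n) - 16 ^ n / 3 ^ n" by (simp only: L_diff L_t)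
    moreover have "\<bar>L n (S n) + 16 ^ n / 3 ^ n\<bar> < 16 ^ n / 3 ^ n" using False by (simp add: L_add L_t not_le)
    ultimately show ?thesis by linarith
  qed (simp add: S_Suc)
  define u where "u n \<phi> = S (Suc n) \<phi> - S n \<phi>" for n \<phi>
  have u_le: "\<bar>u n \<phi>\<bar> \<le> (1 / 3) ^ n" for n \<phi>
    using \<tau>(2)[of "4 * n" \<phi>] by (auto simp: u_def S_Suc t_def power_one_over abs_mult divide_simps)
  have S_sum: "S n \<phi> = (\<Sum>i<n. u i \<phi>)" for n \<phi>
    by (induction n) (simp_all add: S0 u_def)
  define \<sigma> where "\<sigma> \<phi> = (\<Sum>n. u n \<phi>)" for \<phi>
  have geo: "summable (\<lambda>n. (1 / 3 :: real) ^ n)" by (rule summable_geometric) simp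
  have summ: "summable (\<lambda>n. u n \<phi>)" for \<phi>
    using u_le by (intro summable_comparison_test'[OF geo]) simp
  \<comment> \<open>At index \<open>Suc n\<close> this bound is half of \<open>(1 / 3) ^ n\<close>,
    so the later terms can destroy at most half of what \<open>L_S\<close> guarantees for
    \<open>L n\<close>.\<close>
  have tail: "\<bar>\<sigma> \<phi> - S n \<phi>\<bar> \<le> 3 / 2 * (1 / 3) ^ n" for n \<phi>
  proof -
    have geo': "(\<lambda>i. (1 / 3 :: real) ^ (i + n)) sums (3 / 2 * (1 / 3) ^ n)"
      using sums_mult[OF geometric_sums[of "1 / 3 :: real"], of "(1 / 3) ^ n"] by (simp add: power_add mult.commute)
    have "\<sigma> \<phi> - S n \<phi> = (\<Sum>i. u (i + n) \<phi>)"
      unfolding \<sigma>_def S_sum using suminf_minus_initial_segment[OF summ] by simp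
    also have "\<bar>\<dots>\<bar> \<le> (\<Sum>i. (1 / 3 :: real) ^ (i + n))"
      using u_le sums_summable[OF geo'] by (intro norm_suminf_le[where 'a = real, unfolded real_norm_def]) auto
    also have "\<dots> = 3 / 2 * (1 / 3) ^ n" using geo' by (rule sums_unique[symmetric])
    finally show ?thesis .
  qed
  have S_cont: "continuous_map ?X euclideanreal (S n)" for n
  proof (induction n)
    case (Suc n)
    have "continuous_map ?X euclideanreal (t n)"
      unfolding t_def divide_inverse by (intro continuous_map_real_mult_right \<tau>)
    with Suc show ?case
      unfolding S_Suc by (auto intro!: continuous_map_add continuous_map_diff)
  qed (simp add: S0)
  have \<sigma>_cont: "continuous_map ?X euclideanreal \<sigma>"
  proof -
    have "continuous_map ?X Met_TC.mtopology \<sigma>"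
    proof (rule Met_TC.continuous_map_uniform_limit[where F = sequentially and f = S])
      show "\<forall>\<^sub>F n in sequentially. continuous_map ?X Met_TC.mtopology (S n)" using S_cont by simp
      fix e :: real assume e: "e > 0"
      have "(\<lambda>n. 3 / 2 * (1 / 3 :: real) ^ n) \<longlonglongrightarrow> 3 / 2 * 0"
        by (intro tendsto_mult_left LIMSEQ_power_zero) simp
      then have "\<forall>\<^sub>F n in sequentially. 3 / 2 * (1 / 3 :: real) ^ n < e"
        using e by (simp add: order_tendsto_iff)
      then show "\<forall>\<^sub>F n in sequentially. \<forall>x\<in>topspace ?X. \<sigma> x \<in> UNIV \<and> dist (S n x) (\<sigma> x) < e"
        by eventually_elim (auto simp: dist_real_def abs_minus_commute intro: le_less_trans[OF tail])
    qed simp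
    then show ?thesis by simp
  qed
  define \<sigma>' where "\<sigma>' = restrict (\<lambda>\<phi>. complex_of_real (\<sigma> \<phi>)) (character_space B)"
  have "\<sigma>' \<in> Cb_character_space B"
    unfolding Cb_character_space_def
  proof (intro CollectI conjI)
    show "\<sigma>' \<in> extensional (character_space B)" by (simp add: \<sigma>'_def)
    have "continuous_map ?X euclidean (\<lambda>\<phi>. complex_of_real (\<sigma> \<phi>))"
      using continuous_map_compose[OF \<sigma>_cont, of euclidean complex_of_real]
      by (simp add: o_def continuous_on_of_real_id)
    then show "continuous_map ?X euclidean \<sigma>'"
      by (rule continuous_map_eq) (simp add: \<sigma>'_def topspace_gelfand)
    have "\<bar>\<sigma> \<phi>\<bar> \<le> 3 / 2" for \<phi> using tail[of \<phi> 0] by (simp add: S0)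
    then show "bounded (\<sigma>' ` character_space B)"
      by (intro boundedI[of _ "3 / 2"]) (auto simp: \<sigma>'_def)
  qed
  then have "\<sigma>' \<in> C_BSE B" using eq by simp
  from C_BSE_bound_finite[OF this] obtain \<beta> where \<beta>: "\<beta> > 0"
    and bse: "\<forall>\<Phi> c. finite \<Phi> \<longrightarrow> \<Phi> \<subseteq> character_space B \<longrightarrow>
      cmod (\<Sum>\<phi>\<in>\<Phi>. c \<phi> * \<sigma>' \<phi>) \<le> \<beta> * dual_norm B (\<lambda>b. \<Sum>\<phi>\<in>\<Phi>. c \<phi> * \<phi> b)"
    by (elim exE conjE)
  have bound: "(4 / 3 :: real) ^ n \<le> 2 * sqrt 2 * \<beta>" for n
  proof -
    have "complex_of_real (L n \<sigma>) = (\<Sum>\<phi>\<in>\<Phi> (4 * n). complex_of_real (c (4 * n) \<phi>) * \<sigma>' \<phi>)"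
      unfolding L_def \<sigma>'_def of_real_sum using \<Phi>(2) by (intro sum.cong) auto
    then have "\<bar>L n \<sigma>\<bar> = cmod (\<Sum>\<phi>\<in>\<Phi> (4 * n). complex_of_real (c (4 * n) \<phi>) * \<sigma>' \<phi>)"
      by (metis norm_of_real real_norm_def)
    also have "\<dots> \<le> \<beta> * dual_norm B (\<lambda>b. \<Sum>\<phi>\<in>\<Phi> (4 * n). c (4 * n) \<phi> * \<phi> b)"
      by (intro bse[rule_format] \<Phi>)
    also have "\<dots> \<le> \<beta> * sqrt (2 ^ (4 * n + 1))"
      using \<beta> small[of "4 * n"] by (intro mult_left_mono) auto
    also have "sqrt (2 ^ (4 * n + 1)) = sqrt ((4 ^ n)\<^sup>2 * 2)"
      by (simp add: power_mult power2_eq_square flip: power_mult_distrib)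
    also have "\<dots> = 4 ^ n * sqrt 2" by (simp only: real_sqrt_mult real_sqrt_abs) simp
    finally have up: "\<bar>L n \<sigma>\<bar> \<le> \<beta> * (4 ^ n * sqrt 2)" .
    have "\<bar>L n (\<lambda>\<phi>. \<sigma> \<phi> - S (Suc n) \<phi>)\<bar> \<le> 16 ^ n * (1 / 2 * (1 / 3) ^ n)"
      using tail[of _ "Suc n"] by (intro L_le) simp
    then have "16 ^ n / 3 ^ n - 16 ^ n * (1 / 2 * (1 / 3) ^ n) \<le> \<bar>L n \<sigma>\<bar>"
      using L_S[of n] unfolding L_diff by linarith
    also have "16 ^ n / 3 ^ n - 16 ^ n * (1 / 2 * (1 / 3) ^ n) = 4 ^ n * (4 / 3 :: real) ^ n / 2"
      by (simp add: power_divide field_simps flip: power_mult_distrib)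
    also note up
    finally have "4 ^ n * (4 / 3) ^ n \<le> 4 ^ n * (2 * sqrt 2 * \<beta>)" by (simp add: mult_ac)
    then show ?thesis by (rule mult_left_le_imp_le) simp
  qed
  obtain n where "2 * sqrt 2 * \<beta> < (4 / 3 :: real) ^ n" using real_arch_pow[of "4 / 3"] by auto
  with bound[of n] show False by simp
qed

section \<open>Atomic characters of weighted measure algebras\<close>

lemma has_sum_finite_sum:
  fixes f :: "'i \<Rightarrow> 'b \<Rightarrow> 'c::topological_comm_monoid_add"
  assumes "finite I" "\<And>i. i \<in> I \<Longrightarrow> (f i has_sum s i) A"
  shows "((\<lambda>x. \<Sum>i\<in>I. f i x) has_sum (\<Sum>i\<in>I. s i)) A"
  using assms by (induction I rule: finite_induct) (auto intro: has_sum_add)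

locale weighted_measures =
  fixes w :: "'a::{topological_ab_group_add, t2_space} \<Rightarrow> real"
  assumes weight: "weight w" and weight_ge_1: "\<And>x. 1 \<le> w x"
begin

abbreviation "A \<equiv> weighted_measure_algebra w"

lemma weight_measurable: "w \<in> borel_measurable borel" and weight_nonneg: "0 \<le> w x"
  using weight by (auto simp: weight_def intro: less_imp_le)

lemma A_simps: "azero A = (\<lambda>E. 0)" "aplus A = (\<lambda>\<mu> \<nu> E. \<mu> E + \<nu> E)"
  "ascale A = (\<lambda>a \<mu> E. a * \<mu> E)" "amult A = convolution"
  by (simp_all add: weighted_measure_algebra_def)

lemma carrier_complex_borel: "\<mu> \<in> acarrier A \<Longrightarrow> complex_borel_measure \<mu>"
  and carrier_finite: "\<mu> \<in> acarrier A \<Longrightarrow> total_variation \<mu> UNIV < \<infinity>"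
  and carrier_weighted_finite: "\<mu> \<in> acarrier A \<Longrightarrow> total_variation (weighted_measure w \<mu>) UNIV < \<infinity>"
  by (auto simp: weighted_measure_algebra_def bounded_regular_measures_def)

lemma weighted_measure_atom:
  fixes \<mu> :: "'a set \<Rightarrow> complex"
  assumes "\<mu> \<in> acarrier A"
  shows "weighted_measure w \<mu> {x} = w x * \<mu> {x}"
proof -
  let ?f = "\<lambda>y. complex_of_real (indicator {x} y * w y)"
  have fin: "finite {y. e \<le> cmod (?f y)}" if "e > 0" for e
  proof (rule finite_subset)
    show "{y. e \<le> cmod (?f y)} \<subseteq> {x}"
    proof
      fix y assume y: "y \<in> {y. e \<le> cmod (?f y)}"
      show "y \<in> {x}" using y that by (cases "y = x") auto
    qed
  qed simp
  have "complex_integral \<mu> ?f = \<mu> {x} * w x"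
  proof (rule has_sum_unique)
    show "((\<lambda>y. \<mu> {y} * ?f y) has_sum complex_integral \<mu> ?f) UNIV"
      by (intro has_sum_complex_integral carrier_complex_borel carrier_finite assms fin)
    show "((\<lambda>y. \<mu> {y} * ?f y) has_sum \<mu> {x} * w x) UNIV"
      by (intro has_sum_finite_neutralI[of "{x}"]) auto
  qed
  then show ?thesis by (simp add: weighted_measure_def)
qed

text \<open>Here \<open>w \<ge> 1\<close> enters: an atom weighs at least its own mass. It follows
  that a bounded function on the group, summed against atoms, acts with norm at most its
  supremum.\<close>

lemma sum_atoms_le_anorm:
  assumes "\<mu> \<in> acarrier A" "finite F"
  shows "(\<Sum>x\<in>F. cmod (\<mu> {x})) \<le> anorm A \<mu>"
proof -
  have "(\<Sum>x\<in>F. cmod (\<mu> {x})) \<le> (\<Sum>x\<in>F. cmod (weighted_measure w \<mu> {x}))"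
    using weight_ge_1 by (intro sum_mono)
      (simp add: weighted_measure_atom[OF assms(1)] norm_mult mult_le_cancel_right1 weight_nonneg)
  also have "\<dots> = enn2real (ennreal (\<Sum>x\<in>F. cmod (weighted_measure w \<mu> {x})))"
    by (simp add: sum_nonneg)
  also have "\<dots> \<le> enn2real (total_variation (weighted_measure w \<mu>) UNIV)"
    using assms(2) carrier_weighted_finite[OF assms(1)]
    by (intro enn2real_mono sum_singletons_le_total_variation) auto
  finally show ?thesis by (simp add: weighted_measure_algebra_def)
qed

lemma atoms_abs_summable:
  assumes "\<mu> \<in> acarrier A"
  shows "(\<lambda>x. cmod (\<mu> {x})) summable_on UNIV"
  unfolding abs_summable_iff_bdd_above using sum_atoms_le_anorm[OF assms] by (auto intro!: bdd_aboveI2)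

text \<open>Puts \<open>x \<mapsto> \<mu> {x}\<close> into the class of functions whose integrals
  reduce to sums over atoms.\<close>

lemma finite_large_atoms:
  assumes \<mu>: "\<mu> \<in> acarrier A" and e: "e > 0"
  shows "finite {x. e \<le> cmod (\<mu> {x})}"
proof (rule ccontr)
  assume inf: "infinite {x. e \<le> cmod (\<mu> {x})}"
  obtain n :: nat where n: "anorm A \<mu> < n * e" using e reals_Archimedean3 by blast
  obtain F where F: "finite F" "card F = n" "F \<subseteq> {x. e \<le> cmod (\<mu> {x})}"
    using infinite_arbitrarily_large[OF inf] by blast
  have "n * e = (\<Sum>x\<in>F. e)" by (simp add: F)
  also have "\<dots> \<le> (\<Sum>x\<in>F. cmod (\<mu> {x}))" using F(3) by (intro sum_mono) auto
  also have "\<dots> \<le> anorm A \<mu>" by (intro sum_atoms_le_anorm \<mu> F)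
  finally show False using n by simp
qed

text \<open>Translation by \<open>y\<close> pulls \<open>{z}\<close> back to \<open>{z - y}\<close>,
  so the integrand consists of atoms of \<open>\<mu>\<close> and vanishes at infinity in the
  discrete sense; against it only the atoms of \<open>\<nu>\<close> count.\<close>

lemma convolution_atom:
  assumes \<mu>: "\<mu> \<in> acarrier A" and \<nu>: "\<nu> \<in> acarrier A"
  shows "convolution \<mu> \<nu> {z} = (\<Sum>\<^sub>\<infinity>y. \<nu> {y} * \<mu> {z - y})"
proof -
  have "finite {y. e \<le> cmod (\<mu> {z - y})}" if "e > 0" for e
  proof -
    have "{y. e \<le> cmod (\<mu> {z - y})} \<subseteq> (\<lambda>x. z - x) ` {x. e \<le> cmod (\<mu> {x})}"
      by (auto intro!: image_eqI[of _ _ "z - _"])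
    then show ?thesis using finite_large_atoms[OF \<mu> that] finite_surj by blast
  qed
  then have "((\<lambda>y. \<nu> {y} * \<mu> {z - y}) has_sum complex_integral \<nu> (\<lambda>y. \<mu> {z - y})) UNIV"
    by (intro has_sum_complex_integral carrier_complex_borel carrier_finite \<nu>)
  moreover have "(\<lambda>x. x + y) -` {z} = {z - y}" for y by (auto simp: algebra_simps)
  ultimately show ?thesis by (simp add: convolution_def infsumI)
qed

text \<open>Integration of a character of the discrete group against the atomic part of a measure; the
  character need not be continuous or even measurable.\<close>

definition atomic_character :: "('a \<Rightarrow> complex) \<Rightarrow> ('a set \<Rightarrow> complex) \<Rightarrow> complex" where
  "atomic_character \<xi> = restrict (\<lambda>\<mu>. \<Sum>\<^sub>\<infinity>x. \<mu> {x} * \<xi> x) (acarrier A)"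

lemma bounded_mult_abs_summable:
  assumes "\<mu> \<in> acarrier A" "\<And>x. cmod (f x) \<le> K"
  shows "(\<lambda>x. cmod (\<mu> {x} * f x)) summable_on UNIV"
proof (rule Infinite_Sum.abs_summable_on_comparison_test)
  show "(\<lambda>x. cmod (\<mu> {x} * complex_of_real K)) summable_on UNIV"
    using summable_on_cmult_left[OF atoms_abs_summable[OF assms(1)], of "\<bar>K\<bar>"] by (simp add: norm_mult)
  fix x
  show "cmod (\<mu> {x} * f x) \<le> cmod (\<mu> {x} * complex_of_real K)"
    using assms(2)[of x] by (auto simp: norm_mult intro!: mult_left_mono)
qed

lemma character_abs_summable:
  assumes "\<xi> \<in> circle_chars" "\<mu> \<in> acarrier A"
  shows "(\<lambda>x. cmod (\<mu> {x} * \<xi> x)) summable_on UNIV"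
  using circle_charsD(2)[OF assms(1)] by (intro bounded_mult_abs_summable[OF assms(2), of _ 1]) simp

lemma atomic_character_point_mass:
  "atomic_character \<xi> (finsupp_measure {g} (\<lambda>_. 1)) = \<xi> g"
proof -
  have "((\<lambda>x. finsupp_measure {g} (\<lambda>_. 1) {x} * \<xi> x) has_sum \<xi> g) UNIV"
    by (intro has_sum_finite_neutralI[of "{g}"]) (auto simp: finsupp_measure_singleton)
  then show ?thesis
    using finsupp_measure_carrier[OF _ weight_measurable, of "{g}"]
    by (simp add: atomic_character_def infsumI)
qed

text \<open>Point masses recover \<open>\<xi>\<close>, so a block of \<open>2 ^ n\<close>
  circle-valued characters yields as many characters of the algebra.\<close>

lemma atomic_character_inj: "inj atomic_character"
proof (rule injI)
  fix \<xi> \<zeta> assume "atomic_character \<xi> = atomic_character \<zeta>"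
  then have "\<xi> g = \<zeta> g" for g
    using atomic_character_point_mass[of \<xi> g] atomic_character_point_mass[of \<zeta> g] by simp
  then show "\<xi> = \<zeta>" by blast
qed

text \<open>A Cauchy product of absolutely summable families, rearranged along the shear
  \<open>(z, y) \<mapsto> (z - y, y)\<close>. The assumption \<open>closed\<close> is there because
  the functional has its meaning on the carrier only.\<close>

lemma atomic_character_convolution:
  assumes \<xi>: "\<xi> \<in> circle_chars" and \<mu>: "\<mu> \<in> acarrier A" and \<nu>: "\<nu> \<in> acarrier A"
    and closed: "convolution \<mu> \<nu> \<in> acarrier A"
  shows "atomic_character \<xi> (convolution \<mu> \<nu>) = atomic_character \<xi> \<mu> * atomic_character \<xi> \<nu>"
proof -
  define a b where "a x = \<mu> {x} * \<xi> x" and "b x = \<nu> {x} * \<xi> x" for x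
  have a: "(\<lambda>x. cmod (a x)) summable_on UNIV" and b: "(\<lambda>x. cmod (b x)) summable_on UNIV"
    using character_abs_summable[OF \<xi>] \<mu> \<nu> unfolding a_def b_def by auto
  have "(\<lambda>p. cmod (a (fst p) * b (snd p))) summable_on UNIV \<times> UNIV"
    unfolding Infinite_Sum.abs_summable_on_Sigma_iff
  proof (intro conjI ballI)
    show "(\<lambda>y. cmod (a (fst (x, y)) * b (snd (x, y)))) summable_on UNIV" for x
      using summable_on_cmult_right[OF b, of "cmod (a x)"] by (simp add: norm_mult)
    show "(\<lambda>x. norm (\<Sum>\<^sub>\<infinity>y. norm (a (fst (x, y)) * b (snd (x, y))))) summable_on UNIV"
      using summable_on_cmult_left[OF a, of "\<Sum>\<^sub>\<infinity>y. cmod (b y)"]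
      by (simp add: norm_mult infsum_cmult_right' infsum_nonneg)
  qed
  then have ab: "(\<lambda>p. a (fst p) * b (snd p)) summable_on UNIV \<times> UNIV"
    by (rule abs_summable_summable)
  have bij: "bij_betw (\<lambda>(z, y). (z - y, y)) (UNIV \<times> UNIV) (UNIV \<times> UNIV :: ('a \<times> 'a) set)"
    by (rule bij_betwI[where g = "\<lambda>(x, y). (x + y, y)"]) auto
  have shift: "(\<lambda>(z, y). a (z - y) * b y) summable_on UNIV \<times> UNIV"
    using ab summable_on_reindex_bij_betw[OF bij, of "\<lambda>p. a (fst p) * b (snd p)"]
    by (simp add: case_prod_unfold)
  have "atomic_character \<xi> (convolution \<mu> \<nu>) = (\<Sum>\<^sub>\<infinity>z. (\<Sum>\<^sub>\<infinity>y. \<nu> {y} * \<mu> {z - y}) * \<xi> z)"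
    using closed by (simp add: atomic_character_def convolution_atom[OF \<mu> \<nu>])
  also have "\<dots> = (\<Sum>\<^sub>\<infinity>z. \<Sum>\<^sub>\<infinity>y. a (z - y) * b y)"
  proof (rule infsum_cong)
    fix z
    have "\<nu> {y} * \<mu> {z - y} * \<xi> z = a (z - y) * b y" for y
      using circle_charsD(1)[OF \<xi>, of "z - y" y] by (simp add: a_def b_def)
    then show "(\<Sum>\<^sub>\<infinity>y. \<nu> {y} * \<mu> {z - y}) * \<xi> z = (\<Sum>\<^sub>\<infinity>y. a (z - y) * b y)"
      by (simp flip: infsum_cmult_left')
  qed
  also have "\<dots> = infsum (\<lambda>(z, y). a (z - y) * b y) (UNIV \<times> UNIV)"
    by (rule infsum_Sigma'_banach[OF shift])
  also have "\<dots> = infsum (\<lambda>p. a (fst p) * b (snd p)) (UNIV \<times> UNIV)"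
    using infsum_reindex_bij_betw[OF bij, of "\<lambda>p. a (fst p) * b (snd p)"] by (simp add: case_prod_unfold)
  also have "\<dots> = (\<Sum>\<^sub>\<infinity>x. \<Sum>\<^sub>\<infinity>y. a x * b y)"
    using infsum_Sigma_banach[OF ab] by simp
  also have "\<dots> = (\<Sum>\<^sub>\<infinity>x. a x) * (\<Sum>\<^sub>\<infinity>y. b y)"
    by (simp add: infsum_cmult_left' infsum_cmult_right')
  finally show ?thesis using \<mu> \<nu> by (simp add: atomic_character_def a_def b_def)
qed

text \<open>Closure of the carrier under convolution is drawn from \<open>banach\<close>, which
  being a BSE-algebra contains; in this direction it is assumed rather than derived.\<close>

lemma atomic_character_in_character_space:
  assumes banach: "commutative_banach_algebra A" and \<xi>: "\<xi> \<in> circle_chars"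
  shows "atomic_character \<xi> \<in> character_space A"
proof -
  note closed = commutative_banach_algebra.plus_closed[OF banach] commutative_banach_algebra.scale_closed[OF banach]
    commutative_banach_algebra.mult_closed[OF banach]
  have summ: "(\<lambda>x. \<mu> {x} * \<xi> x) summable_on UNIV" if "\<mu> \<in> acarrier A" for \<mu>
    using character_abs_summable[OF \<xi> that] by (rule abs_summable_summable)
  have "atomic_character \<xi> (aplus A \<mu> \<nu>) = atomic_character \<xi> \<mu> + atomic_character \<xi> \<nu>"
    if "\<mu> \<in> acarrier A" "\<nu> \<in> acarrier A" for \<mu> \<nu>
    using closed(1)[OF that] that summ
    by (simp add: atomic_character_def A_simps distrib_right infsum_add)
  moreover have "atomic_character \<xi> (ascale A c \<mu>) = c * atomic_character \<xi> \<mu>"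
    if "\<mu> \<in> acarrier A" for c \<mu>
    using closed(2)[OF that, of c] that
    by (simp add: atomic_character_def A_simps mult.assoc infsum_cmult_right')
  moreover have "atomic_character \<xi> (amult A \<mu> \<nu>) = atomic_character \<xi> \<mu> * atomic_character \<xi> \<nu>"
    if "\<mu> \<in> acarrier A" "\<nu> \<in> acarrier A" for \<mu> \<nu>
    using atomic_character_convolution[OF \<xi> that] closed(3)[OF that] by (simp add: A_simps)
  moreover have "atomic_character \<xi> (finsupp_measure {0} (\<lambda>_. 1)) \<noteq> 0"
    using circle_charsD(2)[OF \<xi>, of 0] by (simp only: atomic_character_point_mass) auto
  moreover have "finsupp_measure {0} (\<lambda>_. 1) \<in> acarrier A"
    by (intro finsupp_measure_carrier weight_measurable) simp
  ultimately show ?thesis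
    unfolding character_space_def by (auto simp: atomic_character_def)
qed

text \<open>On \<open>\<mu>\<close> the combination is the sum of \<open>\<mu> {x}\<close> times a
  trigonometric polynomial bounded by \<open>K\<close>, and the atoms of an element of the unit ball
  have absolute sum at most 1.\<close>

lemma dual_norm_atomic_characters_le:
  assumes banach: "commutative_banach_algebra A" and S: "finite S" "S \<subseteq> circle_chars"
    and K: "\<And>x. cmod (\<Sum>\<xi>\<in>S. c \<xi> * \<xi> x) \<le> K"
  shows "dual_norm A (\<lambda>\<mu>. \<Sum>\<xi>\<in>S. c \<xi> * atomic_character \<xi> \<mu>) \<le> K"
  unfolding dual_norm_def
proof (rule cSUP_least)
  \<comment> \<open>The bound on a real supremum requires a nonempty set; the unit ball contains the
    zero measure.\<close>
  note zero_closed = commutative_banach_algebra.zero_closed[OF banach]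
  have "anorm A (azero A) = 0" using commutative_banach_algebra.norm_eq_zero[OF banach zero_closed] by simp
  then show "{b \<in> acarrier A. anorm A b \<le> 1} \<noteq> {}" using zero_closed by force
  fix \<mu> assume "\<mu> \<in> {b \<in> acarrier A. anorm A b \<le> 1}"
  then have \<mu>: "\<mu> \<in> acarrier A" "anorm A \<mu> \<le> 1" by auto
  have K0: "0 \<le> K" using K[of 0] norm_ge_zero order_trans by blast
  let ?p = "\<lambda>x. \<Sum>\<xi>\<in>S. c \<xi> * \<xi> x"
  have "((\<lambda>x. \<Sum>\<xi>\<in>S. c \<xi> * (\<mu> {x} * \<xi> x)) has_sum (\<Sum>\<xi>\<in>S. c \<xi> * atomic_character \<xi> \<mu>)) UNIV"
  proof (intro has_sum_finite_sum S(1) has_sum_cmult_right)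
    fix \<xi> assume "\<xi> \<in> S"
    then have "(\<lambda>x. \<mu> {x} * \<xi> x) summable_on UNIV"
      using S(2) character_abs_summable[OF _ \<mu>(1)] by (auto intro: abs_summable_summable)
    then show "((\<lambda>x. \<mu> {x} * \<xi> x) has_sum atomic_character \<xi> \<mu>) UNIV"
      using \<mu>(1) by (simp add: atomic_character_def)
  qed
  then have "(\<Sum>\<xi>\<in>S. c \<xi> * atomic_character \<xi> \<mu>) = (\<Sum>\<^sub>\<infinity>x. \<mu> {x} * ?p x)"
    by (simp add: infsumI sum_distrib_left mult_ac)
  also have "cmod \<dots> \<le> (\<Sum>\<^sub>\<infinity>x. cmod (\<mu> {x} * ?p x))"
    by (intro norm_infsum_bound bounded_mult_abs_summable[OF \<mu>(1) K])
  also have "\<dots> \<le> K"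
  proof (rule infsum_le_finite_sums)
    show "(\<lambda>x. cmod (\<mu> {x} * ?p x)) summable_on UNIV"
      by (rule bounded_mult_abs_summable[OF \<mu>(1) K])
    fix F :: "'a set" assume F: "finite F"
    have "(\<Sum>x\<in>F. cmod (\<mu> {x} * ?p x)) \<le> (\<Sum>x\<in>F. cmod (\<mu> {x})) * K"
      unfolding sum_distrib_right norm_mult by (intro sum_mono mult_left_mono K) auto
    also have "\<dots> \<le> 1 * K"
      using sum_atoms_le_anorm[OF \<mu>(1) F] \<mu>(2) K0 by (intro mult_right_mono) auto
    finally show "(\<Sum>x\<in>F. cmod (\<mu> {x} * ?p x)) \<le> K" by simp
  qed
  finally show "cmod (\<Sum>\<xi>\<in>S. c \<xi> * atomic_character \<xi> \<mu>) \<le> K" .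
qed

theorem type_I_BSE_imp_finite:
  assumes "type_I_BSE_algebra A"
  shows "finite (UNIV :: 'a set)"
proof (rule ccontr)
  assume "infinite (UNIV :: 'a set)"
  then have inf: "infinite (circle_chars :: ('a \<Rightarrow> complex) set)" by (rule infinite_circle_chars)
  have banach: "commutative_banach_algebra A" and eq: "C_BSE A = Cb_character_space A"
    using assms by (auto simp: type_I_BSE_algebra_def BSE_algebra_def)
  obtain S :: "nat \<Rightarrow> ('a \<Rightarrow> complex) set" and c :: "nat \<Rightarrow> ('a \<Rightarrow> complex) \<Rightarrow> real"
    where Sc: "\<And>n. S n \<subseteq> circle_chars \<and> card (S n) = 2 ^ n \<and> (\<forall>\<xi>\<in>S n. c n \<xi> \<in> {1, -1}) \<and>
      (\<forall>x. cmod (\<Sum>\<xi>\<in>S n. c n \<xi> * \<xi> x) \<le> sqrt (2 ^ (n + 1)))"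
  proof -
    let ?P = "\<lambda>n S c. S \<subseteq> circle_chars \<and> card S = 2 ^ n \<and> (\<forall>\<xi>\<in>S. c \<xi> \<in> {1, -1 :: real}) \<and>
      (\<forall>x::'a. cmod (\<Sum>\<xi>\<in>S. c \<xi> * \<xi> x) \<le> sqrt (2 ^ (n + 1)))"
    have "\<exists>S. \<forall>n. \<exists>c. ?P n (S n) c" using rudin_shapiro[OF inf] by (intro choice allI)
    then obtain S where "\<forall>n. \<exists>c. ?P n (S n) c" ..
    then have "\<exists>c. \<forall>n. ?P n (S n) (c n)" by (rule choice)
    then obtain c where c: "\<forall>n. ?P n (S n) (c n)" ..
    show ?thesis by (rule that) (rule spec[OF c])
  qed
  have fin: "finite (S n)" for n using Sc[of n] by (intro card_ge_0_finite) simp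
  note inj = inj_on_subset[OF atomic_character_inj subset_UNIV]
  \<comment> \<open>The signs belong to elements of \<open>S n\<close>; injectivity lets them be
    read off from the characters of the algebra.\<close>
  let ?c = "\<lambda>n \<phi>. c n (inv atomic_character \<phi>)"
  have "C_BSE A \<noteq> Cb_character_space A"
  proof (rule C_BSE_neq_Cb[where \<Phi> = "\<lambda>n. atomic_character ` S n" and c = ?c])
    fix n
    show "finite (atomic_character ` S n)" using fin by simp
    show "atomic_character ` S n \<subseteq> character_space A"
      using Sc atomic_character_in_character_space[OF banach] by blast
    show "card (atomic_character ` S n) = 2 ^ n" using Sc[of n] by (simp add: card_image[OF inj])
    show "?c n \<phi> \<in> {1, -1}" if "\<phi> \<in> atomic_character ` S n" for \<phi>
      using that Sc[of n] by (auto simp: inv_f_f[OF atomic_character_inj])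
    have "dual_norm A (\<lambda>b. \<Sum>\<xi>\<in>S n. c n \<xi> * atomic_character \<xi> b) \<le> sqrt (2 ^ (n + 1))"
      using Sc[of n] by (intro dual_norm_atomic_characters_le banach fin) auto
    then show "dual_norm A (\<lambda>b. \<Sum>\<phi>\<in>atomic_character ` S n. ?c n \<phi> * \<phi> b) \<le> sqrt (2 ^ (n + 1))"
      by (simp add: sum.reindex[OF inj] inv_f_f[OF atomic_character_inj])
  qed
  with eq show False by simp
qed

end

section \<open>Unital algebras with finite spectrum\<close>

lemma character_spaceD:
  assumes "\<phi> \<in> character_space B"
  shows "x \<in> acarrier B \<Longrightarrow> y \<in> acarrier B \<Longrightarrow> \<phi> (aplus B x y) = \<phi> x + \<phi> y"
    "x \<in> acarrier B \<Longrightarrow> \<phi> (ascale B a x) = a * \<phi> x"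
    "x \<in> acarrier B \<Longrightarrow> y \<in> acarrier B \<Longrightarrow> \<phi> (amult B x y) = \<phi> x * \<phi> y"
    "\<exists>x\<in>acarrier B. \<phi> x \<noteq> 0"
  using assms by (auto simp: character_space_def)

text \<open>Contractivity of characters is an assumption of the locale; for a finite group it is
  read off from an explicit formula.\<close>

locale unital_finite_spectrum = commutative_banach_algebra B for B :: "'b complex_algebra" +
  fixes e :: 'b
  assumes unit_closed: "e \<in> acarrier B"
    and mult_unit: "x \<in> acarrier B \<Longrightarrow> amult B x e = x"
    and finite_spectrum: "finite (character_space B)"
    and character_norm_le: "\<phi> \<in> character_space B \<Longrightarrow> x \<in> acarrier B \<Longrightarrow> cmod (\<phi> x) \<le> anorm B x"
begin

lemma character_unit: assumes "\<phi> \<in> character_space B" shows "\<phi> e = 1"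
proof -
  obtain x where x: "x \<in> acarrier B" "\<phi> x \<noteq> 0" using character_spaceD(4)[OF assms] by blast
  have "\<phi> x = \<phi> x * \<phi> e" using character_spaceD(3)[OF assms x(1) unit_closed] mult_unit[OF x(1)] by simp
  with x(2) show ?thesis by simp
qed

lemma character_zero: assumes "\<phi> \<in> character_space B" shows "\<phi> (azero B) = 0"
  using character_spaceD(1)[OF assms zero_closed zero_closed] plus_zero[OF zero_closed] by simp

text \<open>Subtracting \<open>\<psi> x\<close> times the unit from an element \<open>x\<close> that
  separates \<open>\<phi>\<close> from \<open>\<psi>\<close> gives a factor vanishing at
  \<open>\<psi>\<close> but not at \<open>\<phi>\<close>; normalised products of such factors handle
  finitely many \<open>\<psi>\<close>.\<close>

lemma character_separating_element:
  assumes \<phi>: "\<phi> \<in> character_space B" and "finite \<Phi>" "\<Phi> \<subseteq> character_space B - {\<phi>}"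
  shows "\<exists>b\<in>acarrier B. \<phi> b = 1 \<and> (\<forall>\<psi>\<in>\<Phi>. \<psi> b = 0)"
  using assms(2,3)
proof (induction \<Phi> rule: finite_induct)
  case empty
  then show ?case using character_unit[OF \<phi>] unit_closed by auto
next
  case (insert \<psi> \<Phi>)
  then obtain b where b: "b \<in> acarrier B" "\<phi> b = 1" "\<And>\<theta>. \<theta> \<in> \<Phi> \<Longrightarrow> \<theta> b = 0" by auto
  have \<psi>: "\<psi> \<in> character_space B" "\<phi> \<noteq> \<psi>" using insert.prems by auto
  obtain x where x: "x \<in> acarrier B" "\<phi> x \<noteq> \<psi> x" using character_space_neq[OF \<phi> \<psi>] by blast
  define y where "y = aplus B x (ascale B (- \<psi> x) e)"
  have y: "y \<in> acarrier B" using x unit_closed by (simp add: y_def plus_closed scale_closed)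
  have val: "\<theta> y = \<theta> x - \<psi> x" if "\<theta> \<in> character_space B" for \<theta>
    using x unit_closed that by (simp add: y_def character_spaceD scale_closed character_unit)
  define c where "c = ascale B (1 / (\<phi> x - \<psi> x)) (amult B b y)"
  have c: "\<theta> c = \<theta> b * (\<theta> x - \<psi> x) / (\<phi> x - \<psi> x)" if "\<theta> \<in> character_space B" for \<theta>
    using that b y by (simp add: c_def character_spaceD mult_closed val)
  have "c \<in> acarrier B" using b y by (simp add: c_def scale_closed mult_closed)
  moreover have "\<phi> c = 1" using x b by (simp add: c[OF \<phi>])
  moreover have "\<theta> c = 0" if "\<theta> \<in> insert \<psi> \<Phi>" for \<theta>
    using that insert.prems b(3) \<psi> by (auto simp: c)
  ultimately show ?case by blast
qed

text \<open>Newton interpolation: the value at a new character is corrected by a multiple of an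
  element that vanishes at the old ones.\<close>

lemma character_interpolation:
  assumes "finite \<Phi>" "\<Phi> \<subseteq> character_space B"
  shows "\<exists>b\<in>acarrier B. \<forall>\<phi>\<in>\<Phi>. \<phi> b = \<sigma> \<phi>"
  using assms
proof (induction \<Phi> rule: finite_induct)
  case empty
  then show ?case using zero_closed by auto
next
  case (insert \<psi> \<Phi>)
  then obtain b where b: "b \<in> acarrier B" "\<And>\<phi>. \<phi> \<in> \<Phi> \<Longrightarrow> \<phi> b = \<sigma> \<phi>" by auto
  obtain c where c: "c \<in> acarrier B" "\<psi> c = 1" "\<And>\<phi>. \<phi> \<in> \<Phi> \<Longrightarrow> \<phi> c = 0"
    using character_separating_element[of \<psi> \<Phi>] insert.prems insert.hyps by auto
  define d where "d = aplus B b (ascale B (\<sigma> \<psi> - \<psi> b) c)"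
  have "\<phi> d = \<sigma> \<phi>" if \<phi>: "\<phi> \<in> insert \<psi> \<Phi>" for \<phi>
  proof -
    have "\<phi> \<in> character_space B" using \<phi> insert.prems by blast
    then have "\<phi> d = \<phi> b + (\<sigma> \<psi> - \<psi> b) * \<phi> c"
      using b(1) c(1) by (simp add: d_def character_spaceD scale_closed)
    then show ?thesis using \<phi> b(2) c(2,3) by (cases "\<phi> = \<psi>") auto
  qed
  moreover have "d \<in> acarrier B" using b c by (simp add: d_def plus_closed scale_closed)
  ultimately show ?case by blast
qed

definition gelfand_transform :: "'b \<Rightarrow> ('b \<Rightarrow> complex) \<Rightarrow> complex" where
  "gelfand_transform b = restrict (\<lambda>\<phi>. \<phi> b) (character_space B)"

lemma gelfand_transform_Cb:
  assumes "b \<in> acarrier B" shows "gelfand_transform b \<in> Cb_character_space B"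
proof -
  have "continuous_map (gelfand_topology B) euclidean (gelfand_transform b)"
    using continuous_map_gelfand_eval[OF assms]
    by (rule continuous_map_eq) (simp add: gelfand_transform_def topspace_gelfand)
  then show ?thesis
    using finite_spectrum
    by (simp add: Cb_character_space_def gelfand_transform_def finite_imp_bounded)
qed

lemma gelfand_transform_surj:
  assumes "\<sigma> \<in> Cb_character_space B" shows "\<exists>b\<in>acarrier B. \<sigma> = gelfand_transform b"
proof -
  obtain b where b: "b \<in> acarrier B" "\<And>\<phi>. \<phi> \<in> character_space B \<Longrightarrow> \<phi> b = \<sigma> \<phi>"
    using character_interpolation[OF finite_spectrum subset_refl] by blast
  have "\<sigma> = gelfand_transform b"
    using assms b(2) unfolding gelfand_transform_def Cb_character_space_def
    by (intro extensionalityI[of \<sigma> "character_space B"]) auto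
  with b show ?thesis by blast
qed

lemma Cb_eq_range_gelfand: "Cb_character_space B = gelfand_transform ` acarrier B"
  using gelfand_transform_Cb gelfand_transform_surj by blast

text \<open>The norm of \<open>b\<close> serves as BSE constant, since \<open>b\<close> divided by
  its norm is a test element for the dual norm.\<close>

lemma norm_sum_characters_le:
  assumes \<phi>: "\<And>j. j < n \<Longrightarrow> \<phi> j \<in> character_space B" and b: "b \<in> acarrier B"
  shows "cmod (\<Sum>j<n. c j * \<phi> j b) \<le> anorm B b * dual_norm B (\<lambda>b. \<Sum>j<(n::nat). c j * \<phi> j b)"
proof (cases "anorm B b = 0")
  case True
  then show ?thesis using norm_eq_zero[OF b] \<phi> by (simp add: character_zero)
next
  case False
  let ?f = "\<lambda>b. \<Sum>j<n. c j * \<phi> j b"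
  let ?r = "anorm B b"
  have r: "?r > 0" using False norm_nonneg[OF b] by simp
  let ?u = "ascale B (1 / ?r) b"
  have u: "?u \<in> {b \<in> acarrier B. anorm B b \<le> 1}"
    using b r by (simp add: scale_closed norm_scale norm_divide)
  \<comment> \<open>A real supremum bounds its members only if the set is bounded above; contractive
    characters supply the crude bound by the coefficients.\<close>
  have "cmod (?f x) \<le> (\<Sum>j<n. cmod (c j))" if "x \<in> {b \<in> acarrier B. anorm B b \<le> 1}" for x
  proof -
    have "cmod (?f x) \<le> (\<Sum>j<n. cmod (c j * \<phi> j x))" by (rule norm_sum)
    also have "\<dots> \<le> (\<Sum>j<n. cmod (c j) * 1)"
    proof (rule sum_mono)
      fix j assume "j \<in> {..<n}"
      then have "cmod (\<phi> j x) \<le> 1" using that character_norm_le[OF \<phi>, of j x] by auto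
      then show "cmod (c j * \<phi> j x) \<le> cmod (c j) * 1"
        unfolding Real_Vector_Spaces.norm_mult by (rule mult_left_mono) simp
    qed
    finally show ?thesis by simp
  qed
  then have "bdd_above ((\<lambda>x. cmod (?f x)) ` {b \<in> acarrier B. anorm B b \<le> 1})" by (rule bdd_aboveI2)
  from cSUP_upper[OF u this] have "cmod (?f ?u) \<le> dual_norm B ?f" by (simp add: dual_norm_def)
  moreover have "?f ?u = ?f b / ?r"
    unfolding sum_divide_distrib using \<phi> b by (intro sum.cong) (auto simp: character_spaceD)
  ultimately have "cmod (?f b) / ?r \<le> dual_norm B ?f" using r by (simp add: norm_divide)
  with r show ?thesis by (simp add: divide_le_eq mult.commute)
qed

lemma C_BSE_eq_Cb: "C_BSE B = Cb_character_space B"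
proof
  show "C_BSE B \<subseteq> Cb_character_space B" by (auto simp: C_BSE_def)
  show "Cb_character_space B \<subseteq> C_BSE B"
  proof
    fix \<sigma> assume \<sigma>: "\<sigma> \<in> Cb_character_space B"
    then obtain b where b: "b \<in> acarrier B" "\<sigma> = gelfand_transform b" using gelfand_transform_surj by blast
    \<comment> \<open>The summand 1 keeps the constant positive when \<open>b\<close> has norm 0; in
      return the dual norm must be known to be nonnegative.\<close>
    have "cmod (\<Sum>j<n. c j * \<sigma> (\<phi> j)) \<le> (anorm B b + 1) * dual_norm B (\<lambda>b. \<Sum>j<n. c j * \<phi> j b)"
      if \<phi>: "\<forall>j<n. \<phi> j \<in> character_space B" for n :: nat and c \<phi>
    proof -
      let ?D = "dual_norm B (\<lambda>b. \<Sum>j<n. c j * \<phi> j b)"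
      have 1: "cmod (\<Sum>j<n. c j * \<phi> j b) \<le> anorm B b * ?D"
        and 2: "cmod (\<Sum>j<n. c j * \<phi> j e) \<le> anorm B e * ?D"
        using \<phi> by (auto intro!: norm_sum_characters_le b unit_closed)
      \<comment> \<open>The inequality at the unit gives this if \<open>e\<close> has positive norm.
        Otherwise \<open>e\<close> is zero, there is no character at all, and the sum is
        empty.\<close>
      have "0 \<le> ?D"
      proof (cases "anorm B e = 0")
        case True
        then have "e = azero B" using norm_eq_zero[OF unit_closed] by simp
        then have "n = 0"
          using character_unit[of "\<phi> 0"] character_zero[of "\<phi> 0"] \<phi> by (cases n) auto
        have "0 \<le> (SUP b\<in>{b \<in> acarrier B. anorm B b \<le> 1}. 0 :: real)"
          using zero_closed norm_eq_zero[OF zero_closed] by (subst cSUP_const) force+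
        then show ?thesis using \<open>n = 0\<close> by (simp add: dual_norm_def)
      next
        case False
        then have "0 < anorm B e" using norm_nonneg[OF unit_closed] by simp
        moreover have "0 \<le> anorm B e * ?D" using 2 norm_ge_zero order_trans by blast
        ultimately show ?thesis by (simp add: zero_le_mult_iff)
      qed
      have "cmod (\<Sum>j<n. c j * \<sigma> (\<phi> j)) = cmod (\<Sum>j<n. c j * \<phi> j b)"
        using \<phi> by (simp add: b(2) gelfand_transform_def)
      also have "\<dots> \<le> (anorm B b + 1) * ?D" using 1 \<open>0 \<le> ?D\<close> by (simp add: distrib_right)
      finally show ?thesis .
    qed
    then show "\<sigma> \<in> C_BSE B"
      using \<sigma> norm_nonneg[OF b(1)] unfolding C_BSE_def by (intro CollectI conjI exI[of _ "anorm B b + 1"]) auto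
  qed
qed

text \<open>A multiplier is multiplication by \<open>T e\<close>. The function in the definition is
  unique because evaluating its equation at \<open>e\<close>, where characters take the value 1,
  determines it.\<close>

lemma multiplier_transform_eq:
  assumes T: "T \<in> multipliers B"
  shows "multiplier_transform B T = gelfand_transform (T e)"
  unfolding multiplier_transform_def
proof (rule the_equality)
  have Te: "T e \<in> acarrier B" and Tmult: "\<And>x. x \<in> acarrier B \<Longrightarrow> T x = amult B x (T e)"
    using T unit_closed mult_unit unfolding multipliers_def by (auto simp: PiE_iff) metis
  show "gelfand_transform (T e) \<in> Cb_character_space B \<and>
    (\<forall>b\<in>acarrier B. \<forall>\<phi>\<in>character_space B. \<phi> (T b) = gelfand_transform (T e) \<phi> * \<phi> b)"
    using Te gelfand_transform_Cb by (auto simp: Tmult[of b for b] gelfand_transform_def character_spaceD)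
  fix \<sigma> assume \<sigma>: "\<sigma> \<in> Cb_character_space B \<and>
    (\<forall>b\<in>acarrier B. \<forall>\<phi>\<in>character_space B. \<phi> (T b) = \<sigma> \<phi> * \<phi> b)"
  have "\<phi> (T e) = \<sigma> \<phi>" if "\<phi> \<in> character_space B" for \<phi>
  proof -
    have "\<phi> (T e) = \<sigma> \<phi> * \<phi> e" using \<sigma> that unit_closed by blast
    then show ?thesis by (simp add: character_unit[OF that])
  qed
  with \<sigma> show "\<sigma> = gelfand_transform (T e)"
    unfolding gelfand_transform_def Cb_character_space_def
    by (intro extensionalityI[of \<sigma> "character_space B"]) auto
qed

lemma multiplication_multiplier:
  assumes b: "b \<in> acarrier B"
  shows "restrict (amult B b) (acarrier B) \<in> multipliers B"
proof -
  have "amult B b (amult B x y) = amult B x (amult B b y)" if "x \<in> acarrier B" "y \<in> acarrier B" for x y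
    using that b mult_assoc[of b x y] mult_assoc[of x b y] mult_commute[of b x] by simp
  then show ?thesis
    using b unfolding multipliers_def
    by (auto simp: mult_closed plus_closed scale_closed mult_plus mult_scale norm_mult intro!: exI[of _ "anorm B b"])
qed

text \<open>BSE-functions, multiplier transforms and continuous functions all coincide with the
  Gelfand transforms of elements.\<close>

lemma type_I_BSE: "type_I_BSE_algebra B"
proof -
  have "without_order B"
    unfolding without_order_def using mult_unit unit_closed by (metis imageI singletonD)
  moreover have "multiplier_transform B ` multipliers B = gelfand_transform ` acarrier B"
  proof (intro equalityI subsetI)
    fix \<sigma> assume "\<sigma> \<in> multiplier_transform B ` multipliers B"
    then obtain T where T: "T \<in> multipliers B" "\<sigma> = gelfand_transform (T e)"
      using multiplier_transform_eq by auto
    then have "T e \<in> acarrier B" using unit_closed by (auto simp: multipliers_def)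
    with T show "\<sigma> \<in> gelfand_transform ` acarrier B" by blast
  next
    fix \<sigma> assume "\<sigma> \<in> gelfand_transform ` acarrier B"
    then obtain b where b: "b \<in> acarrier B" "\<sigma> = gelfand_transform b" by blast
    let ?T = "restrict (amult B b) (acarrier B)"
    have "multiplier_transform B ?T = \<sigma>"
      using multiplier_transform_eq[OF multiplication_multiplier] b unit_closed by (simp add: mult_unit)
    then show "\<sigma> \<in> multiplier_transform B ` multipliers B"
      using multiplication_multiplier[OF b(1)] by blast
  qed
  ultimately show ?thesis
    using commutative_banach_algebra_axioms
    by (simp add: type_I_BSE_algebra_def BSE_algebra_def C_BSE_eq_Cb Cb_eq_range_gelfand)
qed

end

section \<open>Finite groups\<close>

lemma complex_borel_measure_Un:
  assumes \<mu>: "complex_borel_measure \<mu>" and "A \<in> sets borel" "B \<in> sets borel" "A \<inter> B = {}"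
  shows "\<mu> (A \<union> B) = \<mu> A + \<mu> B"
  using complex_borel_measure_parts(1,3)[OF \<mu>, THEN countably_additive_real_Un, OF assms(2-4)]
  by (simp add: complex_eq_iff)

lemma sets_borel_finite:
  assumes "finite (UNIV :: 'a::t1_space set)"
  shows "(E :: 'a set) \<in> sets borel"
  by (intro borel_closed finite_imp_closed finite_subset[OF subset_UNIV assms])

lemma complex_borel_measure_finite:
  fixes \<mu> :: "'a::t1_space set \<Rightarrow> complex"
  assumes fin: "finite (UNIV :: 'a set)" and \<mu>: "complex_borel_measure \<mu>"
  shows "\<mu> = finsupp_measure UNIV (\<lambda>x. \<mu> {x})"
proof
  fix E :: "'a set"
  have "finite E" using fin by (rule finite_subset[OF subset_UNIV])
  then have "\<mu> E = (\<Sum>x\<in>E. \<mu> {x})"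
  proof (induction E rule: finite_induct)
    case (insert x E)
    then have "\<mu> ({x} \<union> E) = \<mu> {x} + \<mu> E"
      by (intro complex_borel_measure_Un[OF \<mu>] sets_borel_finite[OF fin]) auto
    with insert show ?case by simp
  qed (simp add: complex_borel_measure_empty[OF \<mu>])
  then show "\<mu> E = finsupp_measure UNIV (\<lambda>x. \<mu> {x}) E"
    by (simp add: finsupp_measure_def sets_borel_finite[OF fin])
qed

text \<open>Pigeonhole: two multiples of \<open>x\<close> coincide, and their difference
  vanishes.\<close>

lemma finite_group_torsion:
  fixes x :: "'a::ab_group_add"
  assumes "finite (UNIV :: 'a set)"
  shows "\<exists>k::nat>0. (\<Sum>i<k. x) = 0"
proof -
  let ?m = "\<lambda>n::nat. \<Sum>i<n. x"
  have "\<not> inj ?m" using finite_imageD[OF finite_subset[OF subset_UNIV assms]] by blast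
  then obtain i j where "i \<noteq> j" "?m i = ?m j" unfolding inj_def by blast
  then obtain i j where ij: "i < j" "?m i = ?m j"
    by (cases i j rule: linorder_cases) auto
  have "?m j = ?m i + ?m (j - i)" using sum_const_add[of x i "j - i"] ij(1) by simp
  then have "?m (j - i) = 0" using ij(2) by (simp del: sum_constant)
  with ij(1) show ?thesis by (intro exI[of _ "j - i"]) (simp del: sum_constant)
qed

section \<open>The algebra of a finite group in coordinates\<close>

context weighted_measures
begin

context
  assumes fin: "finite (UNIV :: 'a set)"
begin

text \<open>Together with \<open>carrier_cases\<close> this identifies the algebra with all complex
  functions on the group, under group convolution and a weighted sum norm.\<close>

abbreviation M :: "('a \<Rightarrow> complex) \<Rightarrow> 'a set \<Rightarrow> complex" where "M \<equiv> finsupp_measure UNIV"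

lemma M_atom [simp]: "M m {x} = m x"
  by (simp add: finsupp_measure_singleton)

lemma M_carrier: "M m \<in> acarrier A"
  using fin by (intro finsupp_measure_carrier weight_measurable)

lemma carrier_cases: assumes "\<mu> \<in> acarrier A" obtains m where "\<mu> = M m"
  using complex_borel_measure_finite[OF fin carrier_complex_borel[OF assms]] by blast

lemma M_eq_sum: "M m E = (\<Sum>x\<in>E. m x)"
  by (simp add: finsupp_measure_def sets_borel_finite[OF fin])

lemma M_inject: "M m = M n \<longleftrightarrow> m = n"
proof
  assume "M m = M n"
  then have "m x = n x" for x using M_atom[of m x] M_atom[of n x] by simp
  then show "m = n" by blast
qed simp

lemma M_zero: "azero A = M (\<lambda>_. 0)"
  and M_plus: "aplus A (M m) (M n) = M (\<lambda>x. m x + n x)"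
  and M_scale: "ascale A a (M m) = M (\<lambda>x. a * m x)"
  by (auto simp: A_simps M_eq_sum sum.distrib sum_distrib_left)

lemma M_minus: "aminus A (M m) (M n) = M (\<lambda>x. m x - n x)"
  by (simp add: aminus_def M_scale M_plus)

lemma M_mult: "amult A (M m) (M n) = M (\<lambda>z. \<Sum>y\<in>UNIV. n y * m (z - y))"
proof
  fix E :: "'a set"
  have meas: "f \<in> borel_measurable borel" for f :: "'a \<Rightarrow> complex"
    by (intro borel_measurableI) (simp add: sets_borel_finite[OF fin])
  have "convolution (M m) (M n) E = (\<Sum>y\<in>UNIV. n y * (\<Sum>x\<in>(\<lambda>x. x + y) -` E. m x))"
    by (simp add: convolution_def sets_borel_finite[OF fin] complex_integral_finsupp[OF fin meas] M_eq_sum)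
  also have "\<dots> = (\<Sum>y\<in>UNIV. \<Sum>z\<in>E. n y * m (z - y))"
  proof (rule sum.cong[OF refl])
    fix y
    have "(\<Sum>x\<in>(\<lambda>x. x + y) -` E. m x) = (\<Sum>z\<in>E. m (z - y))"
      by (rule sum.reindex_bij_witness[of _ "\<lambda>z. z - y" "\<lambda>x. x + y"]) auto
    then show "n y * (\<Sum>x\<in>(\<lambda>x. x + y) -` E. m x) = (\<Sum>z\<in>E. n y * m (z - y))"
      by (simp add: sum_distrib_left)
  qed
  also have "\<dots> = M (\<lambda>z. \<Sum>y\<in>UNIV. n y * m (z - y)) E"
    unfolding M_eq_sum by (rule sum.swap)
  finally show "amult A (M m) (M n) E = M (\<lambda>z. \<Sum>y\<in>UNIV. n y * m (z - y)) E" by (simp add: A_simps)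
qed

lemma M_norm: "anorm A (M m) = (\<Sum>x\<in>UNIV. w x * cmod (m x))"
  by (rule anorm_finsupp[OF fin weight_measurable weight_nonneg])

lemma sum_shift: "(\<Sum>x\<in>UNIV. f (x - y)) = (\<Sum>x\<in>UNIV. f (x :: 'a))" for f :: "'a \<Rightarrow> 'c::comm_monoid_add"
  by (rule sum.reindex_bij_witness[of _ "\<lambda>x. x + y" "\<lambda>x. x - y"]) auto

lemma sum_reflect: "(\<Sum>x\<in>UNIV. f (y - x)) = (\<Sum>x\<in>UNIV. f (x :: 'a))" for f :: "'a \<Rightarrow> 'c::comm_monoid_add"
  by (rule sum.reindex_bij_witness[of _ "\<lambda>x. y - x" "\<lambda>x. y - x"]) auto

lemma M_mult_commute: "amult A (M m) (M n) = amult A (M n) (M m)"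
proof -
  have "(\<Sum>y\<in>UNIV. n y * m (z - y)) = (\<Sum>y\<in>UNIV. m y * n (z - y))" for z
    using sum_reflect[of "\<lambda>y. m y * n (z - y)" z] by (simp add: mult.commute)
  then show ?thesis by (simp add: M_mult)
qed

text \<open>Substitution \<open>u = x + y\<close> in the inner sum, then an interchange of the two
  sums.\<close>

lemma M_mult_assoc: "amult A (amult A (M m) (M n)) (M p) = amult A (M m) (amult A (M n) (M p))"
proof -
  have "(\<Sum>y\<in>UNIV. p y * (\<Sum>x\<in>UNIV. n x * m (z - y - x))) =
    (\<Sum>u\<in>UNIV. (\<Sum>y\<in>UNIV. p y * n (u - y)) * m (z - u))" for z
  proof -
    have "(\<Sum>y\<in>UNIV. p y * (\<Sum>x\<in>UNIV. n x * m (z - y - x))) =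
      (\<Sum>y\<in>UNIV. p y * (\<Sum>u\<in>UNIV. n (u - y) * m (z - u)))"
    proof (rule sum.cong[OF refl])
      fix y
      have "(\<Sum>x\<in>UNIV. n x * m (z - y - x)) = (\<Sum>u\<in>UNIV. n (u - y) * m (z - u))"
        using sum_shift[of "\<lambda>x. n x * m (z - y - x)" y] by simp
      then show "p y * (\<Sum>x\<in>UNIV. n x * m (z - y - x)) = p y * (\<Sum>u\<in>UNIV. n (u - y) * m (z - u))"
        by (rule arg_cong)
    qed
    also have "\<dots> = (\<Sum>u\<in>UNIV. \<Sum>y\<in>UNIV. p y * n (u - y) * m (z - u))"
      unfolding sum_distrib_left mult.assoc by (rule sum.swap)
    finally show ?thesis by (simp add: sum_distrib_right)
  qed
  then show ?thesis by (simp add: M_mult)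
qed

lemma M_mult_norm: "anorm A (amult A (M m) (M n)) \<le> anorm A (M m) * anorm A (M n)"
proof -
  have "w z * cmod (\<Sum>y\<in>UNIV. n y * m (z - y)) \<le> (\<Sum>y\<in>UNIV. (w y * cmod (n y)) * (w (z - y) * cmod (m (z - y))))" for z
  proof -
    have "w z * cmod (\<Sum>y\<in>UNIV. n y * m (z - y)) \<le> w z * (\<Sum>y\<in>UNIV. cmod (n y) * cmod (m (z - y)))"
      using weight_nonneg by (intro mult_left_mono sum_norm_le) (auto simp: norm_mult)
    also have "\<dots> = (\<Sum>y\<in>UNIV. w z * (cmod (n y) * cmod (m (z - y))))"
      by (rule sum_distrib_left)
    also have "\<dots> \<le> (\<Sum>y\<in>UNIV. (w y * w (z - y)) * (cmod (n y) * cmod (m (z - y))))"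
    proof (intro sum_mono mult_right_mono)
      fix y
      \<comment> \<open>Submultiplicativity at \<open>z = y + (z - y)\<close> distributes the weight
        over the two factors.\<close>
      show "w z \<le> w y * w (z - y)"
        using weight unfolding weight_def by (metis add_diff_cancel_left' add.commute diff_add_cancel)
    qed auto
    finally show ?thesis by (simp add: mult_ac)
  qed
  then have "anorm A (amult A (M m) (M n)) \<le>
    (\<Sum>z\<in>UNIV. \<Sum>y\<in>UNIV. (w y * cmod (n y)) * (w (z - y) * cmod (m (z - y))))"
    unfolding M_mult M_norm by (intro sum_mono)
  also have "\<dots> = (\<Sum>y\<in>UNIV. (w y * cmod (n y)) * (\<Sum>z\<in>UNIV. w (z - y) * cmod (m (z - y))))"
    unfolding sum_distrib_left by (rule sum.swap)
  also have "\<dots> = anorm A (M m) * anorm A (M n)"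
    unfolding M_norm sum_shift[of "\<lambda>x. w x * cmod (m x)"]
    by (simp add: sum_distrib_right[symmetric] mult.commute)
  finally show ?thesis .
qed

lemma cmod_le_M_norm: "cmod (m x) \<le> anorm A (M m)"
proof -
  have "cmod (m x) \<le> w x * cmod (m x)"
    using weight_ge_1[of x] by (simp add: mult_le_cancel_right1)
  also have "\<dots> \<le> (\<Sum>x\<in>UNIV. w x * cmod (m x))"
    using fin weight_nonneg by (intro member_le_sum) auto
  finally show ?thesis by (simp add: M_norm)
qed

text \<open>The norm dominates every coordinate, so a Cauchy sequence converges coordinatewise; with
  finitely many coordinates this is convergence in norm.\<close>

lemma M_complete:
  assumes X: "\<And>n. X n \<in> acarrier A"
    and cauchy: "\<And>e. e > 0 \<Longrightarrow> \<exists>N. \<forall>m\<ge>N. \<forall>n\<ge>N. anorm A (aminus A (X m) (X n)) < e"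
  shows "\<exists>x\<in>acarrier A. (\<lambda>n. anorm A (aminus A (X n) x)) \<longlonglongrightarrow> 0"
proof -
  define a where "a n x = X n {x}" for n x
  have Xa: "X n = M (a n)" for n
    unfolding a_def by (rule complex_borel_measure_finite[OF fin carrier_complex_borel[OF X]])
  have "Cauchy (\<lambda>n. a n x)" for x
  proof (rule metric_CauchyI)
    fix e :: real assume "e > 0"
    then obtain N where N: "\<forall>m\<ge>N. \<forall>n\<ge>N. anorm A (aminus A (X m) (X n)) < e" using cauchy by blast
    have "dist (a m x) (a n x) < e" if "m \<ge> N" "n \<ge> N" for m n
    proof -
      have "anorm A (aminus A (X m) (X n)) < e" using N that by blast
      with cmod_le_M_norm[of "\<lambda>x. a m x - a n x" x] show ?thesis
        by (simp add: Xa M_minus dist_norm)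
    qed
    then show "\<exists>N. \<forall>m\<ge>N. \<forall>n\<ge>N. dist (a m x) (a n x) < e" by blast
  qed
  then have "\<exists>l. (\<lambda>n. a n x) \<longlonglongrightarrow> l" for x using Cauchy_convergent convergent_def by blast
  then obtain l where l: "\<And>x. (\<lambda>n. a n x) \<longlonglongrightarrow> l x" by metis
  have "(\<lambda>n. \<Sum>x\<in>UNIV. w x * cmod (a n x - l x)) \<longlonglongrightarrow> (\<Sum>x\<in>UNIV. w x * cmod (l x - l x))"
    by (intro tendsto_intros l)
  then show ?thesis
    by (intro bexI[of _ "M l"] M_carrier) (simp add: Xa M_minus M_norm)
qed

lemma banach: "commutative_banach_algebra A"
proof unfold_locales
  show "azero A \<in> acarrier A" by (simp add: M_zero M_carrier)
  fix x assume "x \<in> acarrier A"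
  then obtain m where x: "x = M m" by (rule carrier_cases)
  show "ascale A a x \<in> acarrier A" for a by (simp add: x M_scale M_carrier)
  show "aplus A x (azero A) = x" by (simp add: x M_plus M_zero)
  show "aminus A x x = azero A" by (simp add: x M_minus M_zero)
  show "ascale A (a + c) x = aplus A (ascale A a x) (ascale A c x)" for a c
    by (simp add: x M_scale M_plus distrib_right)
  show "ascale A a (ascale A c x) = ascale A (a * c) x" for a c by (simp add: x M_scale mult.assoc)
  show "ascale A 1 x = x" by (simp add: x M_scale)
  show "0 \<le> anorm A x" by (simp add: x M_norm weight_nonneg sum_nonneg)
  show "anorm A x = 0 \<longleftrightarrow> x = azero A"
  proof
    assume "anorm A x = 0"
    then have "m y = 0" for y using cmod_le_M_norm[of m y] by (simp add: x)
    then have "m = (\<lambda>_. 0)" by (rule ext)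
    then show "x = azero A" by (simp add: x M_zero)
  qed (simp add: M_zero M_norm)
  show "anorm A (ascale A a x) = cmod a * anorm A x" for a
    by (simp add: x M_scale M_norm norm_mult sum_distrib_left mult.left_commute)
  fix y assume "y \<in> acarrier A"
  then obtain n where y: "y = M n" by (rule carrier_cases)
  show "aplus A x y \<in> acarrier A" by (simp add: x y M_plus M_carrier)
  show "amult A x y \<in> acarrier A" by (simp add: x y M_mult M_carrier)
  show "aplus A x y = aplus A y x" by (simp add: x y M_plus add.commute)
  show "ascale A a (aplus A x y) = aplus A (ascale A a x) (ascale A a y)" for a
    by (simp add: x y M_scale M_plus distrib_left)
  show "amult A x y = amult A y x" unfolding x y by (rule M_mult_commute)
  show "amult A x (ascale A a y) = ascale A a (amult A x y)" for a
    by (simp add: x y M_scale M_mult sum_distrib_left mult.assoc)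
  show "anorm A (aplus A x y) \<le> anorm A x + anorm A y"
    unfolding x y M_plus M_norm sum.distrib[symmetric] distrib_left[symmetric]
    by (intro sum_mono mult_left_mono norm_triangle_ineq weight_nonneg)
  show "anorm A (amult A x y) \<le> anorm A x * anorm A y" unfolding x y by (rule M_mult_norm)
  fix z assume "z \<in> acarrier A"
  then obtain p where z: "z = M p" by (rule carrier_cases)
  show "aplus A (aplus A x y) z = aplus A x (aplus A y z)" by (simp add: x y z M_plus add.assoc)
  show "amult A (amult A x y) z = amult A x (amult A y z)" unfolding x y z by (rule M_mult_assoc)
  show "amult A x (aplus A y z) = aplus A (amult A x y) (amult A x z)"
    by (simp add: x y z M_plus M_mult distrib_right sum.distrib)
next
  fix X :: "nat \<Rightarrow> _"
  assume "\<And>n. X n \<in> acarrier A"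
    "\<And>e. e > 0 \<Longrightarrow> \<exists>N. \<forall>m\<ge>N. \<forall>n\<ge>N. anorm A (aminus A (X m) (X n)) < e"
  then show "\<exists>x\<in>acarrier A. (\<lambda>n. anorm A (aminus A (X n) x)) \<longlonglongrightarrow> 0" by (rule M_complete)
qed

section \<open>Characters of the algebra of a finite group\<close>

abbreviation point_mass :: "'a \<Rightarrow> 'a set \<Rightarrow> complex" where
  "point_mass g \<equiv> M (\<lambda>x. if x = g then 1 else 0)"

lemma point_mass_mult: "amult A (M m) (point_mass g) = M (\<lambda>x. m (x - g))"
proof -
  have "(\<Sum>y\<in>UNIV. (if y = g then 1 else 0) * m (z - y)) = (\<Sum>y\<in>UNIV. if y = g then m (z - y) else 0)" for z
    by (intro sum.cong) auto
  also have "\<dots> z = m (z - g)" for z using fin by simp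
  finally show ?thesis by (simp add: M_mult)
qed

lemma point_mass_add: "amult A (point_mass g) (point_mass h) = point_mass (g + h)"
  unfolding point_mass_mult M_inject by (auto simp: algebra_simps)

lemma point_mass_unit: "amult A (M m) (point_mass 0) = M m"
  by (simp add: point_mass_mult)

text \<open>Point masses form a basis, so this linear formula shows that a character is determined
  by its values on them. The induction enlarges the set on which \<open>m\<close> is kept.\<close>

lemma character_M:
  assumes \<phi>: "\<phi> \<in> character_space A"
  shows "\<phi> (M m) = (\<Sum>x\<in>UNIV. m x * \<phi> (point_mass x))"
proof -
  have "\<phi> (M (\<lambda>x. if x \<in> F then m x else 0)) = (\<Sum>x\<in>F. m x * \<phi> (point_mass x))" if "finite F" for F
    using that
  proof (induction F rule: finite_induct)
    case empty
    have "\<phi> (ascale A 0 (M m)) = 0" using character_spaceD(2)[OF \<phi> M_carrier, of 0] by simp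
    then show ?case by (simp add: M_scale)
  next
    case (insert g F)
    have "M (\<lambda>x. if x \<in> insert g F then m x else 0) =
      aplus A (ascale A (m g) (point_mass g)) (M (\<lambda>x. if x \<in> F then m x else 0))"
      unfolding M_scale M_plus M_inject using insert.hyps by (intro ext) auto
    moreover have "ascale A (m g) (point_mass g) \<in> acarrier A" by (simp only: M_scale M_carrier)
    ultimately have "\<phi> (M (\<lambda>x. if x \<in> insert g F then m x else 0)) =
      m g * \<phi> (point_mass g) + \<phi> (M (\<lambda>x. if x \<in> F then m x else 0))"
      by (simp only: character_spaceD(1,2)[OF \<phi>] M_carrier)
    with insert show ?case by simp
  qed
  from this[OF fin] show ?thesis by simp
qed

lemma character_point_mass_zero:
  assumes \<phi>: "\<phi> \<in> character_space A" shows "\<phi> (point_mass 0) = 1"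
proof -
  obtain x where x: "x \<in> acarrier A" "\<phi> x \<noteq> 0" using character_spaceD(4)[OF \<phi>] by blast
  obtain m where m: "x = M m" using x(1) by (rule carrier_cases)
  have "\<phi> x = \<phi> x * \<phi> (point_mass 0)"
    using character_spaceD(3)[OF \<phi> M_carrier M_carrier, of m "\<lambda>x. if x = 0 then 1 else 0"]
    unfolding point_mass_unit m .
  with x(2) show ?thesis by simp
qed

lemma character_point_mass_power:
  assumes \<phi>: "\<phi> \<in> character_space A"
  shows "\<phi> (point_mass (\<Sum>i<k. g)) = \<phi> (point_mass g) ^ k"
proof (induction k)
  case (Suc k)
  have "\<phi> (point_mass ((\<Sum>i<k. g) + g)) = \<phi> (point_mass (\<Sum>i<k. g)) * \<phi> (point_mass g)"
    using character_spaceD(3)[OF \<phi> M_carrier M_carrier] by (simp only: point_mass_add[symmetric])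
  then show ?case using Suc by (simp del: sum_constant)
qed (simp add: character_point_mass_zero[OF \<phi>])

text \<open>A power of the point mass at \<open>g\<close> is the unit because \<open>g\<close> has
  finite order. One exponent serves all characters, which is what finiteness of the spectrum
  requires.\<close>

lemma character_point_mass_root:
  "\<exists>k>0. \<forall>\<phi>\<in>character_space A. \<phi> (point_mass g) ^ k = 1"
proof -
  obtain k :: nat where k: "k > 0" "(\<Sum>i<k. g) = 0" using finite_group_torsion[OF fin] by blast
  have "\<phi> (point_mass g) ^ k = 1" if "\<phi> \<in> character_space A" for \<phi>
    using character_point_mass_power[OF that, of g k, unfolded k(2)] character_point_mass_zero[OF that] by simp
  with k(1) show ?thesis by blast
qed

text \<open>A character amounts to one root of unity for each group element, of an order that
  depends on the element only.\<close>

lemma finite_character_space: "finite (character_space A)"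
proof -
  have "\<exists>k. \<forall>g. k g > 0 \<and> (\<forall>\<phi>\<in>character_space A. \<phi> (point_mass g) ^ k g = 1)"
    using character_point_mass_root by (intro choice allI)
  then obtain k where k: "\<forall>g. k g > 0 \<and> (\<forall>\<phi>\<in>character_space A. \<phi> (point_mass g) ^ k g = 1)" ..
  let ?r = "\<lambda>\<phi> g. \<phi> (point_mass g)"
  have "?r ` character_space A \<subseteq> (\<Pi>\<^sub>E g\<in>UNIV. {z. z ^ k g = 1})" using k by auto
  moreover have "finite (\<Pi>\<^sub>E g\<in>UNIV. {z::complex. z ^ k g = 1})"
    using fin k by (intro finite_PiE finite_roots_unity) (auto simp: Suc_le_eq)
  ultimately have "finite (?r ` character_space A)" by (rule finite_subset)
  moreover have "inj_on ?r (character_space A)"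
  proof (rule inj_onI)
    fix \<phi> \<psi> assume \<phi>: "\<phi> \<in> character_space A" and \<psi>: "\<psi> \<in> character_space A" and r: "?r \<phi> = ?r \<psi>"
    have eq: "\<phi> (point_mass g) = \<psi> (point_mass g)" for g by (rule fun_cong[OF r])
    have "\<phi> x = \<psi> x" if "x \<in> acarrier A" for x
    proof -
      obtain m where m: "x = M m" using \<open>x \<in> acarrier A\<close> by (rule carrier_cases)
      have "\<phi> (M m) = (\<Sum>x\<in>UNIV. m x * \<psi> (point_mass x))"
        by (rule trans[OF character_M[OF \<phi>]]) (simp only: eq)
      then show ?thesis unfolding m by (rule trans[OF _ character_M[OF \<psi>, symmetric]])
    qed
    then show "\<phi> = \<psi>" using character_space_neq[OF \<phi> \<psi>] by blast
  qed
  ultimately show ?thesis by (rule finite_imageD)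
qed

text \<open>Roots of unity have modulus 1, so the value is at most the unweighted absolute sum, and
  \<open>w \<ge> 1\<close> does the rest.\<close>

lemma character_le_norm:
  assumes \<phi>: "\<phi> \<in> character_space A" and x: "x \<in> acarrier A"
  shows "cmod (\<phi> x) \<le> anorm A x"
proof -
  obtain m where m: "x = M m" using x by (rule carrier_cases)
  have one: "cmod (\<phi> (point_mass g)) = 1" for g
  proof -
    obtain k where k: "k > 0" "\<phi> (point_mass g) ^ k = 1" using character_point_mass_root[of g] \<phi> by blast
    have "cmod (\<phi> (point_mass g)) ^ k = 1 ^ k" using arg_cong[OF k(2), of cmod] by (simp add: norm_power)
    then show ?thesis by (rule power_eq_imp_eq_base) (simp_all add: k(1))
  qed
  have "cmod (\<phi> x) = cmod (\<Sum>x\<in>UNIV. m x * \<phi> (point_mass x))"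
    unfolding m by (rule arg_cong[OF character_M[OF \<phi>]])
  also have "\<dots> \<le> (\<Sum>x\<in>UNIV. cmod (m x))"
    by (rule order_trans[OF norm_sum]) (simp add: norm_mult one)
  also have "\<dots> \<le> anorm A x"
    unfolding m M_norm using weight_ge_1 by (intro sum_mono) (simp add: mult_le_cancel_right1)
  finally show ?thesis .
qed

lemma finite_imp_type_I_BSE: "type_I_BSE_algebra A"
proof -
  have "unital_finite_spectrum A (point_mass 0)"
  proof (intro unital_finite_spectrum.intro banach unital_finite_spectrum_axioms.intro)
    show "point_mass 0 \<in> acarrier A" by (rule M_carrier)
    show "amult A x (point_mass 0) = x" if "x \<in> acarrier A" for x
      using that by (rule carrier_cases) (simp add: point_mass_unit)
  qed (simp_all add: finite_character_space character_le_norm)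
  then show ?thesis by (rule unital_finite_spectrum.type_I_BSE)
qed

end

end

theorem theorem4p10:
  fixes w :: "'a::{topological_ab_group_add, t2_space} \<Rightarrow> real"
  assumes "locally_compact_space (euclidean :: 'a topology)"
    and "weight w"
    and "\<forall>x. 1 \<le> w x"
  shows "type_I_BSE_algebra (weighted_measure_algebra w) \<longleftrightarrow> finite (UNIV :: 'a set)"
proof -
  interpret weighted_measures w using assms(2,3) by unfold_locales auto
  show ?thesis by (rule iffI[OF type_I_BSE_imp_finite finite_imp_type_I_BSE])
qed

end
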